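(* Let $G$ and $H$ be locally compact groups and let $\Pi\colon H\to G$ be a continuous injective homomorphism. Then the image of $\Pi$ is closed and $\Pi$ is a homeomorphism onto $\mathrm{im}\,\Pi$ if and only if the associated action of $H$ on $L^\infty(G)$ is integrable.
   Context: The action associated to $\Pi$ is $\alpha\colon L^\infty(G)\to L^\infty(G)\bar{\otimes}L^\infty(H)\cong L^\infty(G\times H)$, $\alpha(f)(g,h)=f(g\,\Pi(h))$. It is integrable if the set of those $f\in L^\infty(G)_+$ for which the integral $\int_H f(\,\cdot\,\Pi(h))\,dh_L(h)$ exists in $L^\infty(G)$ (where $h_L$ is the left Haar measure of $H$), i.e. $(\mathrm{id}\otimes h_L)\alpha(f)\in L^\infty(G)_+$, is $\sigma$-weakly dense in $L^\infty(G)_+$. *)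

theory Defs
  imports "HOL-Analysis.Analysis"
begin

text \<open>
  Groups are types of class \<open>topological_group_add\<close>. This class does not assume commutativity:
  the group operation, commutative or not, is written \<open>x + y\<close>, the inverse \<open>- x\<close>, and the
  neutral element \<open>0\<close>.

  No countability assumption is made. A Haar measure need not be \<open>\<sigma>\<close>-finite, and it is a
  Radon measure in the usual sense (outer regular on Borel sets, inner regular on open sets).
\<close>

definition left_haar_measure :: "'a::{topological_group_add,t2_space} measure \<Rightarrow> bool" where
  "left_haar_measure \<mu> \<longleftrightarrow>
     sets \<mu> = sets borel \<and>
     emeasure \<mu> UNIV \<noteq> 0 \<and>
     (\<forall>K. compact K \<longrightarrow> emeasure \<mu> K < \<infinity>) \<and>
     (\<forall>A\<in>sets borel. emeasure \<mu> A = (INF U\<in>{U. open U \<and> A \<subseteq> U}. emeasure \<mu> U)) \<and>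
     (\<forall>U. open U \<longrightarrow> emeasure \<mu> U = (SUP K\<in>{K. compact K \<and> K \<subseteq> U}. emeasure \<mu> K)) \<and>
     (\<forall>g. \<forall>A\<in>sets borel. emeasure \<mu> ((\<lambda>x. g + x) ` A) = emeasure \<mu> A)"

text \<open>
  As usual for Haar measures that are not \<open>\<sigma>\<close>-finite, \<open>L\<^sup>\<infinity>\<close> is formed modulo locally null sets,
  so that it is the dual of \<open>L\<^sup>1\<close>.
\<close>

definition locally_ae :: "'a measure \<Rightarrow> ('a \<Rightarrow> bool) \<Rightarrow> bool" where
  "locally_ae \<mu> P \<longleftrightarrow> (\<forall>A\<in>sets \<mu>. emeasure \<mu> A < \<infinity> \<longrightarrow> (AE x in \<mu>. x \<in> A \<longrightarrow> P x))"

text \<open>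
  Elements of \<open>L\<^sup>\<infinity>\<close> and \<open>L\<^sup>1\<close> are handled through representing functions. On a locally compact group
  every class in \<open>L\<^sup>\<infinity>\<close> has a Borel representative. For Haar measures and continuous homomorphisms,
  the notions below depend only on the classes of these functions.
\<close>

definition linfty :: "'a measure \<Rightarrow> ('a \<Rightarrow> complex) set" where
  "linfty \<mu> = {f \<in> borel_measurable \<mu>. \<exists>C. locally_ae \<mu> (\<lambda>x. norm (f x) \<le> C)}"

definition linfty_pos :: "'a measure \<Rightarrow> ('a \<Rightarrow> complex) set" where
  "linfty_pos \<mu> = {f \<in> linfty \<mu>. locally_ae \<mu> (\<lambda>x. f x \<in> \<real>\<^sub>\<ge>\<^sub>0)}"

definition lone :: "'a measure \<Rightarrow> ('a \<Rightarrow> complex) set" where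
  "lone \<mu> = {\<omega>. integrable \<mu> \<omega>}"

definition lone_pos :: "'a measure \<Rightarrow> ('a \<Rightarrow> complex) set" where
  "lone_pos \<mu> = {\<omega> \<in> lone \<mu>. AE x in \<mu>. \<omega> x \<in> \<real>\<^sub>\<ge>\<^sub>0}"

text \<open>
  The \<open>\<sigma>\<close>-weak topology: the initial topology for the functionals \<open>f \<mapsto> \<integral> f \<omega> d\<mu>\<close> with \<open>\<omega> \<in> L\<^sup>1\<close>.
  On representatives it is not Hausdorff; its open sets are the preimages of the
  \<open>\<sigma>\<close>-weakly open sets of classes, so closure and density have their usual meaning.
\<close>

definition sigma_weak :: "'a measure \<Rightarrow> ('a \<Rightarrow> complex) topology" where
  "sigma_weak \<mu> =
     pullback_topology (linfty \<mu>)
       (\<lambda>f. \<lambda>\<omega>\<in>lone \<mu>. \<integral>x. f x * \<omega> x \<partial>\<mu>)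
       (product_topology (\<lambda>_. euclidean) (lone \<mu>))"

definition action :: "('h \<Rightarrow> 'g::plus) \<Rightarrow> ('g \<Rightarrow> complex) \<Rightarrow> 'g \<times> 'h \<Rightarrow> complex" where
  "action p f = (\<lambda>(g, h). f (g + p h))"

text \<open>The slice \<open>(\<omega> \<otimes> id) F\<close>, where \<open>\<omega> \<in> L\<^sup>1(G)\<close> is viewed as a normal functional on \<open>L\<^sup>\<infinity>(G)\<close>.\<close>

definition slice :: "'g measure \<Rightarrow> ('g \<Rightarrow> complex) \<Rightarrow> ('g \<times> 'h \<Rightarrow> complex) \<Rightarrow> 'h \<Rightarrow> complex" where
  "slice \<mu> \<omega> F = (\<lambda>h. \<integral>g. F (g, h) * \<omega> g \<partial>\<mu>)"

text \<open>
  \<open>(id \<otimes> h\<^sub>L) F = \<phi>\<close> for \<open>\<phi> \<in> L\<^sup>\<infinity>(G)\<^sub>+\<close>. The operator-valued weight \<open>id \<otimes> h\<^sub>L\<close> takes values in the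
  extended positive part of \<open>L\<^sup>\<infinity>(G)\<close>; its value at \<open>F\<close> is determined by
  \<open>\<omega> \<mapsto> h\<^sub>L ((\<omega> \<otimes> id) F)\<close> for positive normal \<open>\<omega>\<close>. A pointwise integral
  \<open>\<integral> F (g, h) dh\<close> would not be well defined on classes without \<open>\<sigma>\<close>-finiteness: for the
  discrete reals mapping to \<open>\<real>\<close>, the indicator function of a point is null, but its integral
  over every orbit is \<open>1\<close>. The slices of \<open>F = action p f\<close> are continuous for
  continuous \<open>p\<close>, so \<open>h\<^sub>L\<close> is unambiguously given on them by the integral with respect to \<open>\<nu>\<close>.
\<close>

definition is_haar_integral ::
    "'g measure \<Rightarrow> 'h measure \<Rightarrow> ('g \<times> 'h \<Rightarrow> complex) \<Rightarrow> ('g \<Rightarrow> complex) \<Rightarrow> bool" where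
  "is_haar_integral \<mu> \<nu> F \<phi> \<longleftrightarrow>
     \<phi> \<in> linfty_pos \<mu> \<and>
     (\<forall>\<omega>\<in>lone_pos \<mu>.
        (\<integral>\<^sup>+h. ennreal (Re (slice \<mu> \<omega> F h)) \<partial>\<nu>) = ennreal (Re (\<integral>g. \<phi> g * \<omega> g \<partial>\<mu>)))"

definition integrable_elements ::
    "'g::plus measure \<Rightarrow> 'h measure \<Rightarrow> ('h \<Rightarrow> 'g) \<Rightarrow> ('g \<Rightarrow> complex) set" where
  "integrable_elements \<mu> \<nu> p =
     {f \<in> linfty_pos \<mu>. \<exists>\<phi>. is_haar_integral \<mu> \<nu> (action p f) \<phi>}"

definition integrable_action :: "'g::plus measure \<Rightarrow> 'h measure \<Rightarrow> ('h \<Rightarrow> 'g) \<Rightarrow> bool" where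
  "integrable_action \<mu> \<nu> p \<longleftrightarrow>
     linfty_pos \<mu> \<subseteq> sigma_weak \<mu> closure_of integrable_elements \<mu> \<nu> p"

end

theory Submission
  imports Defs
begin

text \<open>
  Write \<open>G\<close> for the group \<open>'g\<close> and \<open>H\<close> for the group \<open>'h\<close>. Both directions come down to one
  property of \<open>p\<close>: being \<^emph>\<open>proper\<close>, which for a continuous injective homomorphism of locally compact groups
  is the same as being a homeomorphism onto a closed subgroup.

  If \<open>p\<close> is proper and \<open>k \<ge> 0\<close> is continuous with compact support \<open>K\<close>, then
  \<open>\<phi> g = \<integral> k (g + p h) dh\<close> is continuous. It is also bounded, although \<open>G\<close> need not be compact: by
  left invariance \<open>\<phi>\<close> is constant on the cosets \<open>g + range p\<close>, and on a coset that meets \<open>K\<close> it can be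
  evaluated at a point of \<open>K\<close>, where only the \<open>h\<close> in the compact set \<open>p -` (- K + K)\<close> contribute.
  Tonelli's theorem identifies \<open>\<phi>\<close> with the operator-valued integral of \<open>k\<close>
  (\<open>cc_pos_integrable_element\<close>). Such functions \<open>k\<close> are \<open>\<sigma>\<close>-weakly dense in the positive part of
  \<open>L\<^sup>\<infinity>\<close> (\<open>cc_pos_sigma_weak_dense\<close>).

  Conversely, density is used only to find a single integrable \<open>f\<close> that is not locally null, hence a
  compact \<open>K\<close> of positive measure with \<open>f \<ge> c > 0\<close> on \<open>K\<close>. Let \<open>Q\<close> be a compact neighbourhood of \<open>K\<close>
  and take its indicator as \<open>\<omega>\<close>. The slice at \<open>h\<close> is at least \<open>c \<mu> (K - p h)\<close> once \<open>p h\<close> is close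
  to \<open>0\<close>, and \<open>\<mu> (K - s) = \<Delta> s \<mu> K\<close> with \<open>\<Delta>\<close> the modular function, which is continuous. So the slice
  is bounded below by a positive constant on \<open>p -` N\<close> for some neighbourhood \<open>N\<close> of \<open>0\<close>; as its
  integral is finite, \<open>\<nu> (p -` N) < \<infinity>\<close> (\<open>integrable_action_finite_nbhd\<close>). In a set of finite Haar
  measure only finitely many disjoint translates of a fixed open set fit, and this makes \<open>p -` W\<close>
  relatively compact for a smaller neighbourhood \<open>W\<close> (\<open>finite_nbhd_imp_compact_nbhd\<close>). Translating
  \<open>W\<close> to an arbitrary point of \<open>G\<close> shows that \<open>p\<close> is a closed map (\<open>compact_nbhd_imp_closed_map\<close>).

  Two points need care because Haar measures may fail to be \<open>\<sigma>\<close>-finite and Borel sets of a product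
  need not lie in the product \<open>\<sigma>\<close>-algebra. Tonelli's theorem is only applied to continuous functions,
  cut off to compact rectangles (\<open>tonelli_compact\<close>); and an \<open>L\<^sup>1\<close> function lives on a \<open>\<sigma>\<close>-compact
  set (\<open>sigma_compact_carrier\<close>), so compact rectangles suffice. The continuity of \<open>\<mu> (K - s)\<close> in \<open>s\<close>
  comes from the uniqueness argument for Haar measure, specialised to right translates
  (\<open>right_translate_ratio\<close>).
\<close>

section \<open>Tonelli's theorem for continuous kernels\<close>

text \<open>
  A continuous function on a product of non-metrizable spaces can fail to be measurable for the product
  of the Borel \<open>\<sigma>\<close>-algebras. On a compact rectangle it is measurable: by compactness of \<open>K\<close> and \<open>L\<close> it is
  there a uniform limit of functions that depend on \<open>y\<close> through finitely many values only.
\<close>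
lemma continuous_kernel_measurable:
  fixes F :: "'a::t2_space \<times> 'b::t2_space \<Rightarrow> real"
  assumes F: "continuous_on UNIV F" and K: "compact K" and L: "compact L"
  shows "(\<lambda>z. indicator K (fst z) * indicator L (snd z) * F z) \<in> borel_measurable (borel \<Otimes>\<^sub>M borel)"
proof -
  have Fx: "(\<lambda>x. F (x, y)) \<in> borel_measurable borel" for y
    by (intro borel_measurable_continuous_onI continuous_on_compose2[OF F]) (auto intro!: continuous_intros)
  have approx: "\<exists>G\<in>borel_measurable (borel \<Otimes>\<^sub>M borel). \<forall>x\<in>K. \<forall>y\<in>L. \<bar>G (x, y) - F (x, y)\<bar> \<le> e"
    if e: "e > 0" for e
  proof -
    have "\<exists>Y. open Y \<and> y0 \<in> Y \<and> (\<forall>x\<in>K. \<forall>y\<in>Y. \<bar>F (x, y0) - F (x, y)\<bar> \<le> e)" for y0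
    proof -
      have "continuous_on (UNIV \<times> K) (\<lambda>z. F (snd z, fst z))"
        by (rule continuous_on_compose2[OF F]) (intro continuous_intros, simp)
      then obtain Y where "y0 \<in> Y" "open Y" "\<forall>y\<in>Y\<inter>UNIV. \<forall>x\<in>K. dist (F (x, y)) (F (x, y0)) \<le> e"
        using continuous_on_prod_compactE[OF _ K UNIV_I e, of "\<lambda>z. F (snd z, fst z)" y0]
        unfolding fst_conv snd_conv by blast
      then show ?thesis by (intro exI[of _ Y]) (simp add: dist_real_def abs_minus_commute)
    qed
    then obtain Y where Y: "\<And>y. open (Y y)" "\<And>y. y \<in> Y y"
      "\<And>x y0 y. x \<in> K \<Longrightarrow> y \<in> Y y0 \<Longrightarrow> \<bar>F (x, y0) - F (x, y)\<bar> \<le> e"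
      by metis
    have "\<exists>T\<subseteq>L. finite T \<and> L \<subseteq> (\<Union>y\<in>T. Y y)"
      using compactE_image[OF L, of L Y] Y by (metis UN_iff subsetI)
    then obtain T where T: "finite T" "L \<subseteq> (\<Union>y\<in>T. Y y)" by blast
    \<comment> \<open>Induction on the finite cover makes the pieces disjoint: a later piece overrides the earlier ones.\<close>
    have "\<exists>G\<in>borel_measurable (borel \<Otimes>\<^sub>M borel). \<forall>x\<in>K. \<forall>y\<in>(\<Union>y\<in>T. Y y). \<bar>G (x, y) - F (x, y)\<bar> \<le> e"
      using T(1)
    proof (induction T)
      case empty
      show ?case by (intro bexI[of _ "\<lambda>_. 0"]) auto
    next
      case (insert t T)
      then obtain G where G[measurable]: "G \<in> borel_measurable (borel \<Otimes>\<^sub>M borel)"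
        and Gb: "\<And>x y. x \<in> K \<Longrightarrow> y \<in> (\<Union>y\<in>T. Y y) \<Longrightarrow> \<bar>G (x, y) - F (x, y)\<bar> \<le> e" by blast
      have [measurable]: "Y t \<in> sets borel" using Y(1) by auto
      note [measurable] = Fx
      have "(\<lambda>z. if snd z \<in> Y t then F (fst z, t) else G z) \<in> borel_measurable (borel \<Otimes>\<^sub>M borel)"
        by measurable
      then show ?case
        by (rule bexI[rotated]) (use Gb Y(3) in auto)
    qed
    then show ?thesis using T(2) by blast
  qed
  have "\<exists>G. G \<in> borel_measurable (borel \<Otimes>\<^sub>M borel) \<and> (\<forall>x\<in>K. \<forall>y\<in>L. \<bar>G (x, y) - F (x, y)\<bar> \<le> inverse (real (Suc n)))" for n
    using approx[of "inverse (real (Suc n))"] by auto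
  then obtain G where G[measurable]: "\<And>n. G n \<in> borel_measurable (borel \<Otimes>\<^sub>M borel)"
    and Gb: "\<And>n x y. x \<in> K \<Longrightarrow> y \<in> L \<Longrightarrow> \<bar>G n (x, y) - F (x, y)\<bar> \<le> inverse (real (Suc n))"
    by metis
  have [measurable]: "K \<in> sets borel" "L \<in> sets borel" using K L by (simp_all add: compact_imp_closed)
  show ?thesis
  proof (rule borel_measurable_LIMSEQ_real)
    show "(\<lambda>z. indicator K (fst z) * indicator L (snd z) * G n z) \<in> borel_measurable (borel \<Otimes>\<^sub>M borel)" for n
      by measurable
    fix z :: "'a \<times> 'b"
    have "(\<lambda>n. G n z) \<longlonglongrightarrow> F z" if "fst z \<in> K" "snd z \<in> L"
      by (rule LIM_zero_cancel, rule Lim_null_comparison[OF _ LIMSEQ_inverse_real_of_nat])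
         (use Gb[of "fst z" "snd z"] that in auto)
    then show "(\<lambda>n. indicator K (fst z) * indicator L (snd z) * G n z) \<longlonglongrightarrow> indicator K (fst z) * indicator L (snd z) * F z"
      by (cases "fst z \<in> K \<and> snd z \<in> L") auto
  qed
qed

text \<open>
  Restricting \<open>\<mu>\<close> to \<open>K\<close> and \<open>\<nu>\<close> to \<open>L\<close> gives finite measures, for which the kernel is measurable on the
  product. The weight \<open>w\<close> is an arbitrary Borel function, so that \<open>L\<^sup>1\<close> functions are covered.
\<close>
lemma tonelli_compact:
  fixes F :: "'a::t2_space \<times> 'b::t2_space \<Rightarrow> real" and w :: "'a \<Rightarrow> ennreal"
  assumes F: "continuous_on UNIV F" and K: "compact K" and L: "compact L"
    and sets_\<mu>: "sets \<mu> = sets borel" and sets_\<nu>: "sets \<nu> = sets borel"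
    and fin: "emeasure \<mu> K < \<infinity>" "emeasure \<nu> L < \<infinity>"
    and w: "w \<in> borel_measurable \<mu>"
    and supp: "\<And>x y. x \<in> K \<Longrightarrow> y \<notin> L \<Longrightarrow> F (x, y) = 0"
  shows "(\<lambda>y. \<integral>\<^sup>+x. ennreal (F (x, y)) * w x * indicator K x \<partial>\<mu>) \<in> borel_measurable \<nu>" (is ?A)
    and "(\<integral>\<^sup>+y. (\<integral>\<^sup>+x. ennreal (F (x, y)) * w x * indicator K x \<partial>\<mu>) \<partial>\<nu>)
         = (\<integral>\<^sup>+x. (\<integral>\<^sup>+y. ennreal (F (x, y)) \<partial>\<nu>) * w x * indicator K x \<partial>\<mu>)" (is ?B)
proof -
  have KL[measurable]: "K \<in> sets borel" "L \<in> sets borel" using K L by (simp_all add: compact_imp_closed)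
  have KL'[measurable]: "K \<in> sets \<mu>" "L \<in> sets \<nu>" using KL sets_\<mu> sets_\<nu> by auto
  define M where "M = density \<mu> (indicator K)"
  define N where "N = density \<nu> (indicator L)"
  have sM[measurable_cong]: "sets M = sets borel" and sN[measurable_cong]: "sets N = sets borel"
    by (auto simp: M_def N_def sets_\<mu> sets_\<nu>)
  have [measurable]: "w \<in> borel_measurable M" using w by (simp add: M_def)
  have spaces: "space \<mu> = UNIV" "space \<nu> = UNIV"
    using sets_eq_imp_space_eq[OF sets_\<mu>] sets_eq_imp_space_eq[OF sets_\<nu>] by auto
  interpret M: finite_measure M
    by standard (use fin(1) emeasure_restricted[of K \<mu> UNIV] in \<open>simp add: M_def spaces sets_\<mu>\<close>)
  interpret N: finite_measure N
    by standard (use fin(2) emeasure_restricted[of L \<nu> UNIV] in \<open>simp add: N_def spaces sets_\<nu>\<close>)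
  interpret P: pair_sigma_finite M N ..
  have [measurable]: "(\<lambda>z. indicator K (fst z) * indicator L (snd z) * F z) \<in> borel_measurable (M \<Otimes>\<^sub>M N)"
    using continuous_kernel_measurable[OF F K L] measurable_cong_sets[OF sets_pair_measure_cong[OF sM sN] refl]
    by blast
  define f where "f x y = ennreal (indicator K x * indicator L y * F (x, y)) * w x" for x y
  have f[measurable]: "case_prod f \<in> borel_measurable (M \<Otimes>\<^sub>M N)"
  proof -
    have "case_prod f = (\<lambda>z. ennreal (indicator K (fst z) * indicator L (snd z) * F z) * w (fst z))"
      by (auto simp: f_def)
    then show ?thesis by simp
  qed
  have Fx: "(\<lambda>x. F (x, y)) \<in> borel_measurable borel" for y
    by (intro borel_measurable_continuous_onI continuous_on_compose2[OF F]) (auto intro!: continuous_intros)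
  have Fy: "(\<lambda>y. F (x, y)) \<in> borel_measurable borel" for x
    by (intro borel_measurable_continuous_onI continuous_on_compose2[OF F]) (auto intro!: continuous_intros)
  have fx: "(\<lambda>x. f x y) \<in> borel_measurable \<mu>" for y
  proof -
    have [measurable]: "(\<lambda>x. F (x, y)) \<in> borel_measurable \<mu>" "w \<in> borel_measurable \<mu>"
      using Fx[of y] w by (simp_all add: measurable_cong_sets[OF sets_\<mu> refl])
    show ?thesis unfolding f_def by measurable
  qed
  have inner: "(\<integral>\<^sup>+x. f x y \<partial>M) = (\<integral>\<^sup>+x. ennreal (F (x, y)) * w x * indicator K x \<partial>\<mu>)" for y
  proof -
    have "(\<integral>\<^sup>+x. f x y \<partial>M) = (\<integral>\<^sup>+x. indicator K x * f x y \<partial>\<mu>)"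
      unfolding M_def by (rule nn_integral_density) (use fx in auto)
    also have "\<dots> = (\<integral>\<^sup>+x. ennreal (F (x, y)) * w x * indicator K x \<partial>\<mu>)"
    proof (rule nn_integral_cong)
      fix x
      show "indicator K x * f x y = ennreal (F (x, y)) * w x * indicator K x"
        using supp[of x y] by (cases "x \<in> K"; cases "y \<in> L") (simp_all add: f_def)
    qed
    finally show ?thesis .
  qed
  have "(\<lambda>y. \<integral>\<^sup>+x. f x y \<partial>M) \<in> borel_measurable N"
    by (rule M.borel_measurable_nn_integral) (use f in \<open>simp add: measurable_split_conv\<close>)
  then show ?A unfolding inner by (simp add: N_def)
  have fy: "(\<lambda>y. f x y) \<in> borel_measurable \<nu>" for x
  proof -
    have [measurable]: "(\<lambda>y. F (x, y)) \<in> borel_measurable \<nu>"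
      using Fy[of x] by (simp add: measurable_cong_sets[OF sets_\<nu> refl])
    show ?thesis unfolding f_def by measurable
  qed
  have innerM: "indicator K x * (\<integral>\<^sup>+y. f x y \<partial>N) = (\<integral>\<^sup>+y. ennreal (F (x, y)) \<partial>\<nu>) * w x * indicator K x" for x
  proof (cases "x \<in> K")
    case True
    have "(\<integral>\<^sup>+y. f x y \<partial>N) = (\<integral>\<^sup>+y. indicator L y * f x y \<partial>\<nu>)"
      unfolding N_def by (rule nn_integral_density) (use fy in auto)
    also have "\<dots> = (\<integral>\<^sup>+y. ennreal (F (x, y)) * w x \<partial>\<nu>)"
    proof (rule nn_integral_cong)
      fix y
      show "indicator L y * f x y = ennreal (F (x, y)) * w x"
        using supp[of x y] True by (cases "y \<in> L") (simp_all add: f_def)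
    qed
    also have "\<dots> = (\<integral>\<^sup>+y. ennreal (F (x, y)) \<partial>\<nu>) * w x"
      by (rule nn_integral_multc) (use Fy[of x] in \<open>simp add: measurable_cong_sets[OF sets_\<nu> refl]\<close>)
    finally show ?thesis using True by simp
  qed simp
  have "(\<integral>\<^sup>+y. (\<integral>\<^sup>+x. f x y \<partial>M) \<partial>\<nu>) = (\<integral>\<^sup>+y. (\<integral>\<^sup>+x. f x y \<partial>M) \<partial>N)"
  proof -
    have "(\<integral>\<^sup>+y. (\<integral>\<^sup>+x. f x y \<partial>M) \<partial>N) = (\<integral>\<^sup>+y. indicator L y * (\<integral>\<^sup>+x. f x y \<partial>M) \<partial>\<nu>)"
      unfolding N_def
      by (rule nn_integral_density)
         (use \<open>(\<lambda>y. \<integral>\<^sup>+x. f x y \<partial>M) \<in> borel_measurable N\<close> in \<open>simp_all add: N_def\<close>)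
    also have "\<dots> = (\<integral>\<^sup>+y. (\<integral>\<^sup>+x. f x y \<partial>M) \<partial>\<nu>)"
    proof (rule nn_integral_cong)
      fix y
      show "indicator L y * (\<integral>\<^sup>+x. f x y \<partial>M) = (\<integral>\<^sup>+x. f x y \<partial>M)"
        by (cases "y \<in> L") (simp_all add: f_def)
    qed
    finally show ?thesis by simp
  qed
  also have "\<dots> = (\<integral>\<^sup>+x. (\<integral>\<^sup>+y. f x y \<partial>N) \<partial>M)"
    by (rule P.Fubini') (rule f)
  also have "\<dots> = (\<integral>\<^sup>+x. indicator K x * (\<integral>\<^sup>+y. f x y \<partial>N) \<partial>\<mu>)"
  proof -
    have "(\<lambda>x. \<integral>\<^sup>+y. f x y \<partial>N) \<in> borel_measurable M"
      by (rule N.borel_measurable_nn_integral) (rule f)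
    then have "(\<lambda>x. \<integral>\<^sup>+y. f x y \<partial>N) \<in> borel_measurable \<mu>" by (simp add: M_def)
    then show ?thesis unfolding M_def by (subst nn_integral_density) auto
  qed
  finally show ?B unfolding inner innerM .
qed

section \<open>Radon measures on locally compact spaces\<close>

definition cc_pos :: "('a::topological_space \<Rightarrow> real) set" where
  "cc_pos = {k. continuous_on UNIV k \<and> (\<forall>x. 0 \<le> k x) \<and> (\<exists>K. compact K \<and> (\<forall>x. x \<notin> K \<longrightarrow> k x = 0))}"

lemma finite_superlevel_set:
  assumes w: "w \<in> borel_measurable M" and fin: "(\<integral>\<^sup>+x. w x \<partial>M) < \<infinity>" and c: "c > 0"
  shows "emeasure M {x \<in> space M. ennreal c \<le> w x} < \<infinity>"
proof -
  let ?A = "{x \<in> space M. ennreal c \<le> w x}"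
  have A: "?A \<in> sets M" using w by measurable
  have "ennreal c * emeasure M ?A = (\<integral>\<^sup>+x. ennreal c * indicator ?A x \<partial>M)"
    using A by (simp add: nn_integral_cmult_indicator)
  also have "\<dots> \<le> (\<integral>\<^sup>+x. w x \<partial>M)"
    by (intro nn_integral_mono) (auto split: split_indicator)
  finally have "ennreal c * emeasure M ?A < \<infinity>" using fin by (rule le_less_trans)
  then show ?thesis using c by (auto simp: ennreal_mult_less_top)
qed

lemma continuous_compact_support_bounded:
  fixes f :: "'a::topological_space \<Rightarrow> real"
  assumes f: "continuous_on UNIV f" and K: "compact K" and supp: "\<And>x. x \<notin> K \<Longrightarrow> f x = 0"
  shows "\<exists>B. \<forall>x. \<bar>f x\<bar> \<le> B"
proof -
  have "compact (f ` K)" using K f by (meson compact_continuous_image continuous_on_subset subset_UNIV)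
  then obtain B where B: "\<forall>y\<in>f ` K. norm y \<le> B" using compact_imp_bounded bounded_iff by blast
  have "\<bar>f x\<bar> \<le> max 0 B" for x using B supp[of x] by (cases "x \<in> K") force+
  then show ?thesis by blast
qed

lemma cc_pos_bounded: "k \<in> cc_pos \<Longrightarrow> \<exists>B. \<forall>x. \<bar>k x\<bar> \<le> B"
  unfolding cc_pos_def using continuous_compact_support_bounded by blast

text \<open>
  The topological half of the notion of Haar measure, separated from the group structure.
\<close>
locale radon_measure =
  fixes \<mu> :: "'a::t2_space measure"
  assumes locally_compact: "locally_compact_space (euclidean :: 'a topology)"
    and sets_eq_borel [measurable_cong]: "sets \<mu> = sets borel"
    and finite_compact: "compact K \<Longrightarrow> emeasure \<mu> K < \<infinity>"
    and outer: "A \<in> sets borel \<Longrightarrow> emeasure \<mu> A = (INF U\<in>{U. open U \<and> A \<subseteq> U}. emeasure \<mu> U)"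
    and inner: "open U \<Longrightarrow> emeasure \<mu> U = (SUP K\<in>{K. compact K \<and> K \<subseteq> U}. emeasure \<mu> K)"
begin

lemma space_UNIV [simp]: "space \<mu> = UNIV"
  using sets_eq_imp_space_eq[OF sets_eq_borel] by simp

lemma compact_sets [simp]: "compact K \<Longrightarrow> K \<in> sets \<mu>"
  by (simp add: sets_eq_borel compact_imp_closed)

lemma open_sets [simp]: "open U \<Longrightarrow> U \<in> sets \<mu>"
  by (simp add: sets_eq_borel)

lemma measurable_continuous: "continuous_on UNIV f \<Longrightarrow> f \<in> borel_measurable \<mu>"
  by (simp add: borel_measurable_continuous_onI measurable_cong_sets[OF sets_eq_borel refl])

lemma Hausdorff_euclidean: "Hausdorff_space (euclidean :: 'a topology)"
  unfolding Hausdorff_space_def disjnt_def using hausdorff by (metis openin_open_subtopology open_openin)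

lemma compact_nbhd:
  assumes "compact K"
  obtains V C :: "'a set" where "open V" "compact C" "K \<subseteq> V" "V \<subseteq> C"
proof -
  show ?thesis
    using Hausdorff_euclidean locally_compact_space_compact_closed_compact[of "euclidean :: 'a topology"] locally_compact assms that
    by (auto simp: compactin_euclidean_iff)
qed

lemma compact_nbhd_point:
  fixes x :: 'a
  obtains V C where "open V" "compact C" "x \<in> V" "V \<subseteq> C"
  using compact_nbhd[of "{x}"] by (metis finite.emptyI finite_imp_compact finite_insert insert_subset)

lemma urysohn_cc:
  fixes K U :: "'a set"
  assumes K: "compact K" and U: "open U" and KU: "K \<subseteq> U"
  obtains k where "k \<in> cc_pos" "\<And>x. k x \<le> 1" "\<And>x. x \<in> K \<Longrightarrow> k x = 1" "\<And>x. x \<notin> U \<Longrightarrow> k x = 0"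
proof -
  obtain V C where V: "open V" "compact C" "K \<subseteq> V" "V \<subseteq> C" using compact_nbhd[OF K] .
  have cr: "completely_regular_space (euclidean :: 'a topology)"
    by (rule locally_compact_regular_imp_completely_regular_space[OF locally_compact]) (simp add: Hausdorff_euclidean)
  have "closedin euclidean (- (U \<inter> V))" using U V by auto
  then obtain f where f: "continuous_map euclidean (top_of_set {0..1::real}) f"
     "f ` (- (U \<inter> V)) \<subseteq> {0}" "f ` K \<subseteq> {1}"
    using Urysohn_completely_regular_compact_closed[of 0 1 euclidean K "- (U \<inter> V)"] cr K KU V(3)
    by (auto simp: disjnt_def)
  show ?thesis
  proof
    have "continuous_on UNIV f" "\<And>x. f x \<in> {0..1}"
      using f(1) by (auto simp: continuous_map_in_subtopology)
    moreover have "\<And>x. x \<notin> U \<inter> V \<Longrightarrow> f x = 0" using f(2) by auto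
    ultimately show "f \<in> cc_pos" "\<And>x. f x \<le> 1" "\<And>x. x \<notin> U \<Longrightarrow> f x = 0"
      using V(2,4) unfolding cc_pos_def by (auto intro!: exI[of _ C])
    show "f x = 1" if "x \<in> K" for x using f(3) that by auto
  qed
qed

lemma integrable_continuous_compact_support:
  fixes f :: "'a \<Rightarrow> real"
  assumes f: "continuous_on UNIV f" and K: "compact K" and supp: "\<And>x. x \<notin> K \<Longrightarrow> f x = 0"
  shows "integrable \<mu> f"
proof -
  obtain B where "\<And>x. \<bar>f x\<bar> \<le> B"
    using continuous_compact_support_bounded[OF f K supp] by blast
  then show ?thesis
    using finite_compact[OF K] K supp measurable_continuous[OF f]
    by (intro integrableI_bounded_set[of K _ _ B]) auto
qed

lemma cc_pos_integrable: "k \<in> cc_pos \<Longrightarrow> integrable \<mu> k"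
  unfolding cc_pos_def using integrable_continuous_compact_support by blast

lemma cc_pos_nn_integral: "k \<in> cc_pos \<Longrightarrow> (\<integral>\<^sup>+x. ennreal (k x) \<partial>\<mu>) = ennreal (\<integral>x. k x \<partial>\<mu>)"
  using cc_pos_integrable[of k] by (intro nn_integral_eq_integral) (auto simp: cc_pos_def)

text \<open>
  The supports of \<open>F (y, _)\<close> lie locally in \<open>y\<close> in a common compact \<open>L\<close>, of finite measure, and on \<open>L\<close> the
  functions \<open>F (y, _)\<close> converge uniformly as \<open>y\<close> tends to a given point.
\<close>
lemma continuous_parametric_integral:
  fixes F :: "'b::topological_space \<times> 'a \<Rightarrow> real"
  assumes F: "continuous_on UNIV F"
    and supp: "\<And>y. \<exists>V L. open V \<and> y \<in> V \<and> compact L \<and> (\<forall>y\<in>V. \<forall>x. x \<notin> L \<longrightarrow> F (y, x) = 0)"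
  shows "continuous_on UNIV (\<lambda>y. \<integral>x. F (y, x) \<partial>\<mu>)" and "integrable \<mu> (\<lambda>x. F (y, x))"
proof -
  have Fy: "continuous_on UNIV (\<lambda>x. F (y, x))" for y
    by (rule continuous_on_compose2[OF F]) (auto intro!: continuous_intros)
  show int: "integrable \<mu> (\<lambda>x. F (y, x))" for y
    using supp[of y] integrable_continuous_compact_support[OF Fy] by metis
  show "continuous_on UNIV (\<lambda>y. \<integral>x. F (y, x) \<partial>\<mu>)"
    unfolding continuous_on_def tendsto_iff
  proof (intro ballI allI impI)
    fix y0 :: 'b and e :: real assume e: "e > 0"
    obtain V L where V: "open V" "y0 \<in> V" and L: "compact L"
      and VL: "\<And>y x. y \<in> V \<Longrightarrow> x \<notin> L \<Longrightarrow> F (y, x) = 0"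
      using supp[of y0] by blast
    define d where "d = e / (measure \<mu> L + 1)"
    have mp: "measure \<mu> L + 1 > 0" by (simp add: add_nonneg_pos)
    then have d: "d > 0" using e by (simp add: d_def)
    obtain W where W: "y0 \<in> W" "open W" "\<forall>y\<in>W \<inter> UNIV. \<forall>x\<in>L. dist (F (y, x)) (F (y0, x)) \<le> d"
      by (rule continuous_on_prod_compactE[OF continuous_on_subset[OF F subset_UNIV] L UNIV_I d])
    have "dist (\<integral>x. F (y, x) \<partial>\<mu>) (\<integral>x. F (y0, x) \<partial>\<mu>) < e" if y: "y \<in> V \<inter> W" for y
    proof -
      have "dist (\<integral>x. F (y, x) \<partial>\<mu>) (\<integral>x. F (y0, x) \<partial>\<mu>) = norm (\<integral>x. F (y, x) - F (y0, x) \<partial>\<mu>)"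
        using int by (simp add: dist_norm)
      also have "\<dots> \<le> (\<integral>x. d * indicator L x \<partial>\<mu>)"
      proof (rule order_trans[OF integral_norm_bound integral_mono])
        show "integrable \<mu> (\<lambda>x. norm (F (y, x) - F (y0, x)))" using int by simp
        show "integrable \<mu> (\<lambda>x. d * indicator L x)"
          using finite_compact[OF L] L by simp
        show "norm (F (y, x) - F (y0, x)) \<le> d * indicator L x" for x
          using W(3) y V VL[of y x] VL[of y0 x] by (cases "x \<in> L") (auto simp: dist_norm)
      qed
      also have "\<dots> = d * measure \<mu> L" by simp
      also have "\<dots> < d * (measure \<mu> L + 1)" using d by simp
      also have "\<dots> = e" using mp by (simp add: d_def)
      finally show ?thesis .
    qed
    then show "\<forall>\<^sub>F y in at y0. dist (\<integral>x. F (y, x) \<partial>\<mu>) (\<integral>x. F (y0, x) \<partial>\<mu>) < e"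
      unfolding eventually_at_topological using V W by (intro exI[of _ "V \<inter> W"]) auto
  qed
qed

lemma outer_approx:
  assumes A: "A \<in> sets borel" and fin: "emeasure \<mu> A < \<infinity>" and e: "e > 0"
  obtains U where "open U" "A \<subseteq> U" "emeasure \<mu> U < emeasure \<mu> A + e"
proof -
  have "(INF U\<in>{U. open U \<and> A \<subseteq> U}. emeasure \<mu> U) < emeasure \<mu> A + e"
    unfolding outer[OF A, symmetric] using fin e by (simp add: ennreal_add_left_cancel_less less_top)
  then show ?thesis using that by (auto simp: INF_less_iff)
qed

text \<open>
  Inner regularity is only given for open sets. To reach \<open>A\<close> from inside, choose an open \<open>U\<close> around \<open>A\<close>,
  a compact \<open>C \<subseteq> U\<close> of almost full measure, and remove from \<open>C\<close> an open set \<open>V\<close> of small measure that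
  contains \<open>U - A\<close>.
\<close>
lemma inner_outer_approx:
  fixes e :: real
  assumes A: "A \<in> sets borel" and fin: "emeasure \<mu> A < \<infinity>" and e: "e > 0"
  obtains K U where "compact K" "open U" "K \<subseteq> A" "A \<subseteq> U" "emeasure \<mu> (U - K) < ennreal e"
proof -
  \<comment> \<open>The error collects one \<open>d\<close> from \<open>U - C\<close> and two from \<open>V\<close>.\<close>
  define d where "d = e / 4"
  have d: "ennreal d > 0" "d > 0" using e by (auto simp: d_def)
  obtain U where U: "open U" "A \<subseteq> U" "emeasure \<mu> U < emeasure \<mu> A + ennreal d"
    using outer_approx[OF A fin d(1)] .
  have finU: "emeasure \<mu> U < \<infinity>" using U(3) fin less_top by force
  have "emeasure \<mu> (U - A) + emeasure \<mu> A = emeasure \<mu> U"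
    using U A by (subst plus_emeasure) (auto simp: sets_eq_borel Un_absorb2)
  then have UA: "emeasure \<mu> (U - A) < ennreal d"
    using U(3) fin by (metis add.commute ennreal_add_left_cancel_less)
  have BUA: "U - A \<in> sets borel" using U A by auto
  obtain V where V: "open V" "U - A \<subseteq> V" "emeasure \<mu> V < emeasure \<mu> (U - A) + ennreal d"
    using outer_approx[OF BUA _ d(1)] UA less_top by (metis infinity_ennreal_def ennreal_less_top order_less_trans)
  have VV: "emeasure \<mu> V < ennreal (2 * d)"
  proof -
    have "emeasure \<mu> (U - A) + ennreal d \<le> ennreal d + ennreal d" using UA by (intro add_mono) auto
    then show ?thesis using V(3) d by (simp add: ennreal_plus[symmetric] del: ennreal_plus)
  qed
  have "\<exists>C. compact C \<and> C \<subseteq> U \<and> emeasure \<mu> U < emeasure \<mu> C + ennreal d"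
  proof (cases "emeasure \<mu> U = 0")
    case True
    then show ?thesis using d by (intro exI[of _ "{}"]) auto
  next
    case False
    then have "emeasure \<mu> U - ennreal d < emeasure \<mu> U"
      using finU d by (intro ennreal_between) (auto simp: zero_less_iff_neq_zero)
    then have "emeasure \<mu> U - ennreal d < (SUP K\<in>{K. compact K \<and> K \<subseteq> U}. emeasure \<mu> K)"
      using inner[OF U(1)] by simp
    then obtain C where "compact C" "C \<subseteq> U" "emeasure \<mu> U - ennreal d < emeasure \<mu> C"
      by (auto simp: less_SUP_iff)
    then show ?thesis
      using ennreal_minus_mono[of "emeasure \<mu> C + ennreal d" "emeasure \<mu> U" "ennreal d" "ennreal d"]
      by (intro exI[of _ C]) (auto simp: not_less[symmetric])
  qed
  then obtain C where C: "compact C" "C \<subseteq> U" "emeasure \<mu> U < emeasure \<mu> C + ennreal d" by blast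
  have "emeasure \<mu> (U - C) + emeasure \<mu> C = emeasure \<mu> U"
    using U C by (subst plus_emeasure) (auto simp: Un_absorb2)
  then have UC: "emeasure \<mu> (U - C) < ennreal d"
    using C(3) finite_compact[OF C(1)] by (metis add.commute ennreal_add_left_cancel_less)
  show ?thesis
  proof
    show "compact (C - V)" using C V by (simp add: compact_diff)
    show "open U" "A \<subseteq> U" "C - V \<subseteq> A" using U C V by auto
    have "emeasure \<mu> (U - (C - V)) \<le> emeasure \<mu> ((U - C) \<union> V)"
      using U C V by (intro emeasure_mono) (auto intro!: sets.Un sets.Diff)
    also have "\<dots> \<le> emeasure \<mu> (U - C) + emeasure \<mu> V"
      using U C V by (intro emeasure_subadditive) (auto intro!: sets.Diff)
    also have "\<dots> \<le> ennreal d + ennreal (2 * d)"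
      using UC VV by (intro add_mono) auto
    also have "\<dots> < ennreal e"
      using e by (simp add: ennreal_plus[symmetric] d_def ennreal_less_iff del: ennreal_plus)
    finally show "emeasure \<mu> (U - (C - V)) < ennreal e" .
  qed
qed

lemma compact_subset_positive:
  assumes "A \<in> sets borel" "emeasure \<mu> A < \<infinity>" "emeasure \<mu> A > 0"
  obtains K where "compact K" "K \<subseteq> A" "emeasure \<mu> K > 0"
proof -
  define e where "e = enn2real (emeasure \<mu> A)"
  have e: "e > 0" "emeasure \<mu> A = ennreal e" using assms by (auto simp: e_def enn2real_positive_iff)
  obtain K U where K: "compact K" "open U" "K \<subseteq> A" "A \<subseteq> U" "emeasure \<mu> (U - K) < ennreal e"
    using inner_outer_approx[OF assms(1,2) e(1)] .
  have "emeasure \<mu> K \<noteq> 0"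
  proof
    assume "emeasure \<mu> K = 0"
    then have "emeasure \<mu> A \<le> emeasure \<mu> (U - K)"
      using emeasure_Diff_null_set[of K \<mu> U] K assms emeasure_mono[of A U \<mu>] by (auto simp: null_sets_def)
    then show False using K e by simp
  qed
  then show ?thesis using K that by (auto simp: zero_less_iff_neq_zero)
qed

lemma sigma_compact_carrier_set:
  assumes A: "A \<in> sets borel" and fin: "emeasure \<mu> A < \<infinity>"
  shows "\<exists>C::nat \<Rightarrow> 'a set. (\<forall>j. compact (C j)) \<and> (AE x in \<mu>. x \<in> A \<longrightarrow> x \<in> (\<Union>j. C j))"
proof -
  have "\<exists>K. compact K \<and> emeasure \<mu> (A - K) < ennreal (inverse (real (Suc j)))" for j
  proof -
    obtain K U where K: "compact K" "open U" "K \<subseteq> A" "A \<subseteq> U"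
        "emeasure \<mu> (U - K) < ennreal (inverse (real (Suc j)))"
      using inner_outer_approx[OF A fin, of "inverse (real (Suc j))"] by auto
    moreover have "emeasure \<mu> (A - K) \<le> emeasure \<mu> (U - K)"
      using K by (intro emeasure_mono) auto
    ultimately show ?thesis by (meson le_less_trans)
  qed
  then obtain C where C: "\<And>j. compact (C j)" "\<And>j. emeasure \<mu> (A - C j) < ennreal (inverse (real (Suc j)))"
    by metis
  have [measurable]: "A - (\<Union>j. C j) \<in> sets \<mu>"
    using A C by (intro sets.Diff sets.countable_UN) (auto simp: sets_eq_borel[symmetric])
  have "emeasure \<mu> (A - (\<Union>j. C j)) \<le> ennreal (inverse (real (Suc j)))" for j
  proof -
    have "emeasure \<mu> (A - (\<Union>j. C j)) \<le> emeasure \<mu> (A - C j)"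
      using A C by (intro emeasure_mono) (auto simp: sets_eq_borel compact_imp_closed)
    then show ?thesis using C(2)[of j] by simp
  qed
  then have "emeasure \<mu> (A - (\<Union>j. C j)) \<le> ennreal 0"
    by (intro LIMSEQ_le_const[OF tendsto_ennrealI[OF LIMSEQ_inverse_real_of_nat]]) auto
  then have "A - (\<Union>j. C j) \<in> null_sets \<mu>" by (simp add: null_sets_def)
  from AE_not_in[OF this] have "AE x in \<mu>. x \<in> A \<longrightarrow> x \<in> (\<Union>j. C j)"
    by eventually_elim auto
  then show ?thesis using C(1) by blast
qed

text \<open>
  Since \<open>w\<close> is integrable, its superlevel sets have finite measure, and countably many of them exhaust
  \<open>{x. w x \<noteq> 0}\<close>. This replaces \<open>\<sigma>\<close>-finiteness of \<open>\<mu>\<close> in every interchange of integrals with \<open>\<mu>\<close>.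
\<close>
lemma sigma_compact_carrier:
  fixes w :: "'a \<Rightarrow> ennreal"
  assumes w[measurable]: "w \<in> borel_measurable \<mu>" and fin: "(\<integral>\<^sup>+x. w x \<partial>\<mu>) < \<infinity>"
  obtains K :: "nat \<Rightarrow> 'a set"
  where "\<And>n. compact (K n)" "incseq K" "AE x in \<mu>. w x \<noteq> 0 \<longrightarrow> x \<in> (\<Union>n. K n)"
proof -
  define A where "A m = {x. w x \<ge> ennreal (inverse (real (Suc m)))}" for m
  have A: "A m \<in> sets \<mu>" for m
    using measurable_sets[of w \<mu> borel "{ennreal (inverse (real (Suc m)))..}"] by (auto simp: A_def vimage_def)
  have finA: "emeasure \<mu> (A m) < \<infinity>" for m
    using finite_superlevel_set[OF w fin, of "inverse (real (Suc m))"] by (simp add: A_def)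
  have "\<exists>C::nat \<Rightarrow> 'a set. (\<forall>j. compact (C j)) \<and> (AE x in \<mu>. x \<in> A m \<longrightarrow> x \<in> (\<Union>j. C j))" for m
    using sigma_compact_carrier_set A[unfolded sets_eq_borel] finA by blast
  then obtain C :: "nat \<Rightarrow> nat \<Rightarrow> 'a set" where C: "\<And>m j. compact (C m j)"
    "\<And>m. AE x in \<mu>. x \<in> A m \<longrightarrow> x \<in> (\<Union>j. C m j)"
    by metis
  define K where "K n = (\<Union>m\<le>n. \<Union>j\<le>n. C m j)" for n
  show ?thesis
  proof
    show "compact (K n)" for n unfolding K_def using C(1) by (intro compact_UN) auto
    show "incseq K" unfolding K_def incseq_def by (intro allI impI UN_mono) auto
    have "AE x in \<mu>. \<forall>m. x \<in> A m \<longrightarrow> x \<in> (\<Union>j. C m j)"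
      unfolding AE_all_countable using C(2) by blast
    then show "AE x in \<mu>. w x \<noteq> 0 \<longrightarrow> x \<in> (\<Union>n. K n)"
    proof eventually_elim
      case (elim x)
      show ?case
      proof
        assume "w x \<noteq> 0"
        have "\<exists>m. x \<in> A m"
        proof (cases "w x = \<infinity>")
          case True
          then show ?thesis by (auto simp: A_def)
        next
          case False
          with \<open>w x \<noteq> 0\<close> have "enn2real (w x) > 0"
            by (simp add: enn2real_positive_iff less_top zero_less_iff_neq_zero)
          then obtain m where "inverse (real (Suc m)) < enn2real (w x)" using reals_Archimedean by blast
          then have "ennreal (inverse (real (Suc m))) \<le> ennreal (enn2real (w x))" by (intro ennreal_leI) simp
          then have "ennreal (inverse (real (Suc m))) \<le> w x" using False by (simp only: ennreal_enn2real less_top infinity_ennreal_def)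
          then show ?thesis unfolding A_def by blast
        qed
        then obtain m j where "x \<in> C m j" using elim by auto
        moreover have "m \<in> {..max m j}" "j \<in> {..max m j}" by auto
        ultimately have "x \<in> K (max m j)" unfolding K_def by blast
        then show "x \<in> (\<Union>n. K n)" by blast
      qed
    qed
  qed
qed

end

section \<open>Right translates of a Haar measure\<close>

lemma compact_set_diff:
  fixes A B :: "'a::topological_group_add set"
  assumes "compact A" "compact B"
  shows "compact ((\<lambda>(a, b). a - b) ` (A \<times> B))" "compact ((\<lambda>(a, b). - b + a) ` (A \<times> B))"
proof -
  have "continuous_on (A \<times> B) (\<lambda>(a, b). a - b)" "continuous_on (A \<times> B) (\<lambda>(a, b). - b + a)"
    unfolding split_beta diff_conv_add_uminus by (intro continuous_intros)+
  then show "compact ((\<lambda>(a, b). a - b) ` (A \<times> B))" "compact ((\<lambda>(a, b). - b + a) ` (A \<times> B))"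
    by (simp_all add: compact_continuous_image compact_Times assms)
qed

lemma continuous_on_diff_group [continuous_intros]:
  fixes f g :: "_ \<Rightarrow> 'a::topological_group_add"
  shows "continuous_on S f \<Longrightarrow> continuous_on S g \<Longrightarrow> continuous_on S (\<lambda>x. f x - g x)"
  unfolding diff_conv_add_uminus by (intro continuous_intros)

lemma open_translate_vimage:
  fixes U :: "'a::topological_group_add set"
  assumes "open U"
  shows "open ((\<lambda>t. t + s) -` U)" "open ((\<lambda>t. s + t) -` U)"
  using assms by (auto intro!: open_vimage continuous_intros)

lemma left_translate_image_eq_vimage:
  fixes g :: "'a::group_add"
  shows "(\<lambda>x. g + x) ` U = (\<lambda>x. - g + x) -` U"
  by (auto simp: image_iff add.assoc[symmetric] intro!: bexI[of _ "- g + _"])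

lemma compact_right_translate_vimage:
  fixes K :: "'a::topological_group_add set"
  assumes "compact K"
  shows "compact ((\<lambda>t. t + s) -` K)"
proof -
  have "(\<lambda>t. t + s) -` K = (\<lambda>x. x - s) ` K"
    by (auto simp: image_iff intro!: bexI[of _ "_ + s"])
  then show ?thesis by (simp add: compact_continuous_image continuous_on_diff_group assms)
qed

lemma cc_pos_right_translate:
  fixes k :: "'a::topological_group_add \<Rightarrow> real"
  assumes "k \<in> cc_pos"
  shows "(\<lambda>t. k (t + s)) \<in> cc_pos"
proof -
  obtain K where k: "continuous_on UNIV k" "\<And>x. 0 \<le> k x" "compact K" "\<And>x. x \<notin> K \<Longrightarrow> k x = 0"
    using assms by (auto simp: cc_pos_def)
  have "continuous_on UNIV (\<lambda>t. k (t + s))"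
    by (rule continuous_on_compose2[OF k(1)]) (auto intro!: continuous_intros)
  moreover have "compact ((\<lambda>t. t + s) -` K)" by (rule compact_right_translate_vimage[OF k(3)])
  moreover have "k (t + s) = 0" if "t \<notin> (\<lambda>t. t + s) -` K" for t
    using that k(4) by simp
  ultimately show ?thesis using k(2) unfolding cc_pos_def by blast
qed

locale left_haar = radon_measure \<mu>
  for \<mu> :: "'a::{topological_group_add,t2_space} measure" +
  assumes nonzero: "emeasure \<mu> UNIV \<noteq> 0"
    and left_invariant: "A \<in> sets borel \<Longrightarrow> emeasure \<mu> ((\<lambda>x. g + x) ` A) = emeasure \<mu> A"
begin

lemma measurable_translate: "(\<lambda>x. g + x) \<in> measurable \<mu> \<mu>" "(\<lambda>x. x + g) \<in> measurable \<mu> \<mu>"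
  by (simp_all add: measurable_cong_sets[OF sets_eq_borel sets_eq_borel])
     (intro borel_measurable_continuous_onI continuous_intros)+

lemma distr_left_translate: "distr \<mu> \<mu> (\<lambda>x. g + x) = \<mu>"
proof (rule measure_eqI)
  fix A assume A: "A \<in> sets (distr \<mu> \<mu> (\<lambda>x. g + x))"
  then have A': "A \<in> sets borel" by (simp add: sets_eq_borel)
  have "(\<lambda>x. g + x) -` A = (\<lambda>x. - g + x) ` A"
    by (simp add: left_translate_image_eq_vimage)
  then show "emeasure (distr \<mu> \<mu> (\<lambda>x. g + x)) A = emeasure \<mu> A"
    using A left_invariant[OF A', of "- g"] by (simp add: emeasure_distr measurable_translate)
qed simp

lemma nn_integral_left_translate:
  assumes "f \<in> borel_measurable \<mu>"
  shows "(\<integral>\<^sup>+x. f (g + x) \<partial>\<mu>) = (\<integral>\<^sup>+x. f x \<partial>\<mu>)"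
proof -
  have "(\<integral>\<^sup>+x. f x \<partial>\<mu>) = (\<integral>\<^sup>+x. f x \<partial>distr \<mu> \<mu> (\<lambda>x. g + x))" by (simp add: distr_left_translate)
  also have "\<dots> = (\<integral>\<^sup>+x. f (g + x) \<partial>\<mu>)" using assms by (simp add: nn_integral_distr measurable_translate)
  finally show ?thesis by simp
qed

text \<open>
  A null open set would have null translates; finitely many of them cover any compact set, and inner
  regularity of the whole space would make \<open>\<mu>\<close> zero.
\<close>
lemma open_positive:
  assumes U: "open U" "U \<noteq> {}"
  shows "emeasure \<mu> U > 0"
proof (rule ccontr)
  assume "\<not> emeasure \<mu> U > 0"
  then have U0: "emeasure \<mu> U = 0" by (simp add: zero_less_iff_neq_zero)
  obtain u where u: "u \<in> U" using U by blast
  have null: "(\<lambda>x. g + x) ` U \<in> null_sets \<mu>" for g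
  proof -
    have "open ((\<lambda>x. g + x) ` U)"
      unfolding left_translate_image_eq_vimage by (rule open_translate_vimage(2)[OF U(1)])
    then show ?thesis using left_invariant[of U g] U U0 by (auto simp: null_sets_def)
  qed
  have "emeasure \<mu> K = 0" if K: "compact K" for K
  proof -
    have "K \<subseteq> (\<Union>g\<in>K. (\<lambda>x. u - g + x) -` U)" using u by auto
    then obtain T where T: "finite T" "K \<subseteq> (\<Union>g\<in>T. (\<lambda>x. u - g + x) -` U)"
      using compactE_image[OF K, of K "\<lambda>g. (\<lambda>x. u - g + x) -` U"] open_translate_vimage(2)[OF U(1)] by metis
    have "(\<lambda>x. u - g + x) -` U \<in> null_sets \<mu>" for g
      using null[of "- (u - g)"] unfolding left_translate_image_eq_vimage by simp
    then have "(\<Union>g\<in>T. (\<lambda>x. u - g + x) -` U) \<in> null_sets \<mu>" using T(1) by (intro null_sets.finite_UN) auto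
    then show ?thesis using T(2) K
      by (metis compact_sets null_sets_subset null_setsD1)
  qed
  then have "emeasure \<mu> UNIV = 0" unfolding inner[OF open_UNIV] by (auto intro!: SUP_eq_const)
  then show False using nonzero by simp
qed

lemma cc_pos_integral_positive:
  assumes k: "k \<in> cc_pos" and x: "k x > 0"
  shows "(\<integral>x. k x \<partial>\<mu>) > 0"
proof -
  have k': "continuous_on UNIV k" "\<And>x. 0 \<le> k x" using k by (auto simp: cc_pos_def)
  have "open {x. k x > 0}" using k'(1) by (intro open_Collect_less continuous_intros)
  then have "emeasure \<mu> {x. k x > 0} > 0" using x by (intro open_positive) auto
  moreover have "{x \<in> space \<mu>. k x \<noteq> 0} = {x. k x > 0}" using k'(2) by (auto simp: less_le)
  ultimately have "(\<integral>x. k x \<partial>\<mu>) \<noteq> 0"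
    using integral_nonneg_eq_0_iff_AE[OF cc_pos_integrable[OF k]] k'(2) measurable_continuous[OF k'(1)]
    by (auto simp: AE_iff_measurable[OF _ refl])
  then show ?thesis using k'(2) Bochner_Integration.integral_nonneg[of \<mu> k] by (simp add: less_le)
qed

lemma continuous_right_translate_integral:
  assumes "k \<in> cc_pos"
  shows "continuous_on UNIV (\<lambda>s. \<integral>t. k (t + s) \<partial>\<mu>)"
proof -
  obtain K where k: "continuous_on UNIV k" "compact K" "\<And>x. x \<notin> K \<Longrightarrow> k x = 0"
    using assms by (auto simp: cc_pos_def)
  have "continuous_on UNIV (\<lambda>y. \<integral>x. (\<lambda>(s, t). k (t + s)) (y, x) \<partial>\<mu>)"
  proof (rule continuous_parametric_integral(1))
    show "continuous_on UNIV (\<lambda>(s, t). k (t + s))"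
      unfolding split_beta by (rule continuous_on_compose2[OF k(1)]) (auto intro!: continuous_intros)
    fix s :: 'a
    obtain V C where V: "open V" "compact C" "s \<in> V" "V \<subseteq> C" by (rule compact_nbhd_point)
    have "k (t + s') = 0" if "s' \<in> V" "t \<notin> (\<lambda>(a, b). a - b) ` (K \<times> C)" for s' t
    proof (rule k(3), rule notI)
      assume "t + s' \<in> K"
      then have "t = (\<lambda>(a, b). a - b) (t + s', s')" "(t + s', s') \<in> K \<times> C"
        using that(1) V(4) by auto
      then show False using that(2) by blast
    qed
    then show "\<exists>V L. open V \<and> s \<in> V \<and> compact L \<and> (\<forall>y\<in>V. \<forall>x. x \<notin> L \<longrightarrow> (\<lambda>(s, t). k (t + s)) (y, x) = 0)"
      using V compact_set_diff(1)[OF k(2) V(2)]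
      by (intro exI[of _ V] exI[of _ "(\<lambda>(a, b). a - b) ` (K \<times> C)"]) simp
  qed
  then show ?thesis by simp
qed

text \<open>
  The point is that \<open>k\<close> and \<open>g\<close> become separated on the right, and \<open>g\<close> enters in a factor that does not
  depend on \<open>k\<close>. Two substitutions by left translations are used, one in each variable, with an
  interchange of the integrals before each.
\<close>
lemma right_translate_identity:
  assumes g: "g \<in> cc_pos" and k: "k \<in> cc_pos"
  shows "(\<integral>\<^sup>+s. (\<integral>\<^sup>+t. ennreal (k (t + s)) \<partial>\<mu>) * ennreal (g s) \<partial>\<mu>)
       = (\<integral>\<^sup>+s. ennreal (k s) \<partial>\<mu>) * (\<integral>\<^sup>+t. ennreal (g (- t)) \<partial>\<mu>)"
proof -
  obtain K where k': "continuous_on UNIV k" "compact K" "\<And>x. x \<notin> K \<Longrightarrow> k x = 0"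
    using k by (auto simp: cc_pos_def)
  obtain L where g': "continuous_on UNIV g" "compact L" "\<And>x. x \<notin> L \<Longrightarrow> g x = 0"
    using g by (auto simp: cc_pos_def)
  have [measurable]: "k \<in> borel_measurable \<mu>" "g \<in> borel_measurable \<mu>"
    using k'(1) g'(1) measurable_continuous by auto
  have mg: "(\<lambda>s. g (- s)) \<in> borel_measurable \<mu>"
    by (rule measurable_continuous, rule continuous_on_compose2[OF g'(1)]) (auto intro!: continuous_intros)
  have mg': "(\<lambda>s. g (- t + s)) \<in> borel_measurable \<mu>" for t
    by (rule measurable_continuous, rule continuous_on_compose2[OF g'(1)]) (auto intro!: continuous_intros)
  have kL: "ennreal (k s) * indicator K s = ennreal (k s)" for s using k'(3)[of s] by (cases "s \<in> K") auto
  have gL: "ennreal (g s) * indicator L s = ennreal (g s)" for s using g'(3)[of s] by (cases "s \<in> L") auto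
  have "(\<integral>\<^sup>+s. (\<integral>\<^sup>+t. ennreal (k (t + s)) \<partial>\<mu>) * ennreal (g s) \<partial>\<mu>)
     = (\<integral>\<^sup>+s. (\<integral>\<^sup>+t. ennreal ((\<lambda>(s, t). k (t + s)) (s, t)) \<partial>\<mu>) * ennreal (g s) * indicator L s \<partial>\<mu>)"
    by (simp add: gL mult.assoc)
  also have "\<dots> = (\<integral>\<^sup>+t. (\<integral>\<^sup>+s. ennreal ((\<lambda>(s, t). k (t + s)) (s, t)) * ennreal (g s) * indicator L s \<partial>\<mu>) \<partial>\<mu>)"
  proof (rule tonelli_compact(2)[symmetric])
    show "continuous_on UNIV (\<lambda>(s, t). k (t + s))"
      unfolding split_beta by (rule continuous_on_compose2[OF k'(1)]) (auto intro!: continuous_intros)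
    show "compact ((\<lambda>(a, b). a - b) ` (K \<times> L))" by (rule compact_set_diff(1)[OF k'(2) g'(2)])
    then show "emeasure \<mu> ((\<lambda>(a, b). a - b) ` (K \<times> L)) < \<infinity>" by (rule finite_compact)
    show "(\<lambda>(s, t). k (t + s)) (s, t) = 0" if s: "s \<in> L" and t: "t \<notin> (\<lambda>(a, b). a - b) ` (K \<times> L)" for s t
    proof -
      have "t + s \<notin> K"
      proof
        assume "t + s \<in> K"
        then have "t = (\<lambda>(a, b). a - b) (t + s, s)" "(t + s, s) \<in> K \<times> L" using s by auto
        then show False using t by blast
      qed
      then show ?thesis using k'(3) by simp
    qed
  qed (use g' finite_compact sets_eq_borel in auto)
  \<comment> \<open>With \<open>s = - t + (t + s)\<close>, left invariance turns \<open>t + s\<close> into the new variable \<open>s\<close>.\<close>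
  also have "\<dots> = (\<integral>\<^sup>+t. (\<integral>\<^sup>+s. ennreal (k (t + s)) * ennreal (g (- t + (t + s))) \<partial>\<mu>) \<partial>\<mu>)"
    by (simp add: gL mult.assoc add.assoc[symmetric])
  also have "\<dots> = (\<integral>\<^sup>+t. (\<integral>\<^sup>+s. ennreal (k s) * ennreal (g (- t + s)) \<partial>\<mu>) \<partial>\<mu>)"
  proof (rule nn_integral_cong)
    fix t
    show "(\<integral>\<^sup>+s. ennreal (k (t + s)) * ennreal (g (- t + (t + s))) \<partial>\<mu>) = (\<integral>\<^sup>+s. ennreal (k s) * ennreal (g (- t + s)) \<partial>\<mu>)"
      by (rule nn_integral_left_translate[of "\<lambda>s. ennreal (k s) * ennreal (g (- t + s))"]) (use mg' in simp)
  qed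
  also have "\<dots> = (\<integral>\<^sup>+t. (\<integral>\<^sup>+s. ennreal ((\<lambda>(s, t). g (- t + s)) (s, t)) * ennreal (k s) * indicator K s \<partial>\<mu>) \<partial>\<mu>)"
    by (simp add: kL mult.assoc) (simp add: mult.commute)
  also have "\<dots> = (\<integral>\<^sup>+s. (\<integral>\<^sup>+t. ennreal ((\<lambda>(s, t). g (- t + s)) (s, t)) \<partial>\<mu>) * ennreal (k s) * indicator K s \<partial>\<mu>)"
  proof (rule tonelli_compact(2))
    show "continuous_on UNIV (\<lambda>(s, t). g (- t + s))"
      unfolding split_beta by (rule continuous_on_compose2[OF g'(1)]) (auto intro!: continuous_intros)
    show "compact ((\<lambda>(a, b). a - b) ` (K \<times> L))" by (rule compact_set_diff(1)[OF k'(2) g'(2)])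
    then show "emeasure \<mu> ((\<lambda>(a, b). a - b) ` (K \<times> L)) < \<infinity>" by (rule finite_compact)
    show "(\<lambda>(s, t). g (- t + s)) (s, t) = 0" if s: "s \<in> K" and t: "t \<notin> (\<lambda>(a, b). a - b) ` (K \<times> L)" for s t
    proof -
      have "- t + s \<notin> L"
      proof
        assume "- t + s \<in> L"
        then have "t = (\<lambda>(a, b). a - b) (s, - t + s)" "(s, - t + s) \<in> K \<times> L"
          using s by (auto simp: diff_conv_add_uminus minus_add add.assoc[symmetric] simp del: add_uminus_conv_diff)
        then show False using t by blast
      qed
      then show ?thesis using g'(3) by simp
    qed
  qed (use k' finite_compact sets_eq_borel in auto)
  also have "\<dots> = (\<integral>\<^sup>+s. (\<integral>\<^sup>+t. ennreal (g (- t)) \<partial>\<mu>) * ennreal (k s) \<partial>\<mu>)"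
  proof -
    \<comment> \<open>Replace \<open>t\<close> by \<open>s + t\<close>, which removes \<open>s\<close> from the inner integral.\<close>
    have "(\<integral>\<^sup>+t. ennreal (g (- t + s)) \<partial>\<mu>) = (\<integral>\<^sup>+t. ennreal (g (- t)) \<partial>\<mu>)" for s
    proof -
      have "(\<integral>\<^sup>+t. ennreal (g (- t + s)) \<partial>\<mu>) = (\<integral>\<^sup>+t. ennreal (g (- (- s + t))) \<partial>\<mu>)"
        by (simp add: minus_add)
      also have "\<dots> = (\<integral>\<^sup>+t. ennreal (g (- t)) \<partial>\<mu>)"
        by (rule nn_integral_left_translate[of "\<lambda>t. ennreal (g (- t))"]) (use mg in simp)
      finally show ?thesis .
    qed
    then show ?thesis by (simp add: kL mult.assoc)
  qed
  also have "\<dots> = (\<integral>\<^sup>+s. ennreal (k s) \<partial>\<mu>) * (\<integral>\<^sup>+t. ennreal (g (- t)) \<partial>\<mu>)"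
    by (subst nn_integral_cmult) (auto simp: mult.commute)
  finally show ?thesis .
qed

text \<open>
  If \<open>a s > b s\<close>, a bump function supported in \<open>{x. b x < a x}\<close> tells the two apart, because nonempty
  open sets have positive measure.
\<close>
lemma continuous_le_if_weak_eq:
  assumes a: "continuous_on UNIV a" "\<And>x. 0 \<le> (a x :: real)" and b: "continuous_on UNIV b" "\<And>x. 0 \<le> b x"
    and eq: "\<And>g. g \<in> cc_pos \<Longrightarrow> (\<integral>\<^sup>+s. ennreal (a s) * ennreal (g s) \<partial>\<mu>) = (\<integral>\<^sup>+s. ennreal (b s) * ennreal (g s) \<partial>\<mu>)"
  shows "a (s :: 'a) \<le> b s"
proof (rule ccontr)
  assume "\<not> a s \<le> b s"
  then have s: "{s} \<subseteq> {x. b x < a x}" by auto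
  have "open {x. b x < a x}" using a b by (intro open_Collect_less)
  then obtain g where g: "g \<in> cc_pos" "\<And>x. g x \<le> 1" "\<And>x. x \<in> {s} \<Longrightarrow> g x = 1" "\<And>x. x \<notin> {x. b x < a x} \<Longrightarrow> g x = 0"
    using urysohn_cc[OF _ _ s] by auto
  obtain K where g': "continuous_on UNIV g" "\<And>x. 0 \<le> g x" "compact K" "\<And>x. x \<notin> K \<Longrightarrow> g x = 0"
    using g by (auto simp: cc_pos_def)
  have bg: "(\<lambda>x. b x * g x) \<in> cc_pos" and ag: "(\<lambda>x. a x * g x) \<in> cc_pos"
    using a b g' unfolding cc_pos_def by (auto intro!: continuous_intros exI[of _ K])
  have dg: "(\<lambda>x. (a x - b x) * g x) \<in> cc_pos"
  proof -
    have "0 \<le> (a x - b x) * g x" for x using g(4)[of x] g'(2)[of x] by (cases "b x < a x") auto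
    then show ?thesis using a b g' unfolding cc_pos_def by (auto intro!: continuous_intros exI[of _ K])
  qed
  have "(\<integral>s. a s * g s \<partial>\<mu>) = (\<integral>s. b s * g s \<partial>\<mu>)"
    using eq[OF g(1)] cc_pos_nn_integral[OF ag] cc_pos_nn_integral[OF bg] a b g'
    by (auto simp: ennreal_mult[symmetric] Bochner_Integration.integral_nonneg)
  then have "(\<integral>x. (a x - b x) * g x \<partial>\<mu>) = 0"
    using cc_pos_integrable[OF ag] cc_pos_integrable[OF bg] by (simp add: left_diff_distrib)
  moreover have "(\<integral>x. (a x - b x) * g x \<partial>\<mu>) > 0"
    by (rule cc_pos_integral_positive[OF dg, of s]) (use g(3)[of s] s in auto)
  ultimately show False by simp
qed

text \<open>
  By \<open>right_translate_identity\<close>, both sides have the same integral against every \<open>g\<close> in \<open>cc_pos\<close>; as they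
  are continuous in \<open>s\<close>, they agree. Thus \<open>\<integral> k (t + s) dt\<close> is \<open>\<integral> k t dt\<close> times a factor that depends on
  \<open>s\<close> only, which is the modular function.
\<close>
lemma right_translate_ratio:
  assumes f: "f \<in> cc_pos" and k: "k \<in> cc_pos"
  shows "(\<integral>t. f (t + s) \<partial>\<mu>) * (\<integral>t. k t \<partial>\<mu>) = (\<integral>t. k (t + s) \<partial>\<mu>) * (\<integral>t. f t \<partial>\<mu>)"
proof -
  have le: "(\<integral>t. f (t + s) \<partial>\<mu>) * (\<integral>t. k t \<partial>\<mu>) \<le> (\<integral>t. k (t + s) \<partial>\<mu>) * (\<integral>t. f t \<partial>\<mu>)"
    if f: "f \<in> cc_pos" and k: "k \<in> cc_pos" for f k
  proof (rule continuous_le_if_weak_eq[where a = "\<lambda>s. (\<integral>t. f (t + s) \<partial>\<mu>) * (\<integral>t. k t \<partial>\<mu>)"])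
    have pos: "0 \<le> f x" "0 \<le> k x" for x using f k by (auto simp: cc_pos_def)
    show "continuous_on UNIV (\<lambda>s. (\<integral>t. f (t + s) \<partial>\<mu>) * (\<integral>t. k t \<partial>\<mu>))"
      "continuous_on UNIV (\<lambda>s. (\<integral>t. k (t + s) \<partial>\<mu>) * (\<integral>t. f t \<partial>\<mu>))"
      using continuous_right_translate_integral f k by (auto intro!: continuous_intros)
    show "0 \<le> (\<integral>t. f (t + x) \<partial>\<mu>) * (\<integral>t. k t \<partial>\<mu>)" "0 \<le> (\<integral>t. k (t + x) \<partial>\<mu>) * (\<integral>t. f t \<partial>\<mu>)" for x
      using pos by (auto intro!: mult_nonneg_nonneg Bochner_Integration.integral_nonneg)
    fix g :: "'a \<Rightarrow> real" assume g: "g \<in> cc_pos"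
    have mg: "g \<in> borel_measurable \<mu>" using g measurable_continuous by (auto simp: cc_pos_def)
    have *: "(\<integral>\<^sup>+s. ennreal ((\<integral>t. f (t + s) \<partial>\<mu>) * (\<integral>t. k t \<partial>\<mu>)) * ennreal (g s) \<partial>\<mu>)
      = (\<integral>\<^sup>+s. ennreal (f s) \<partial>\<mu>) * (\<integral>\<^sup>+t. ennreal (g (- t)) \<partial>\<mu>) * (\<integral>\<^sup>+t. ennreal (k t) \<partial>\<mu>)"
      if f: "f \<in> cc_pos" and k: "k \<in> cc_pos" for f k
    proof -
      have pos: "0 \<le> f x" "0 \<le> k x" for x using f k by (auto simp: cc_pos_def)
      have [measurable]: "(\<lambda>s. (\<integral>t. f (t + s) \<partial>\<mu>)) \<in> borel_measurable \<mu>" 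
        by (rule measurable_continuous[OF continuous_right_translate_integral[OF f]])
      have "(\<integral>\<^sup>+s. ennreal ((\<integral>t. f (t + s) \<partial>\<mu>) * (\<integral>t. k t \<partial>\<mu>)) * ennreal (g s) \<partial>\<mu>)
        = (\<integral>\<^sup>+s. (ennreal (\<integral>t. f (t + s) \<partial>\<mu>) * ennreal (g s)) * ennreal (\<integral>t. k t \<partial>\<mu>) \<partial>\<mu>)"
        using pos by (intro nn_integral_cong) (simp add: ennreal_mult Bochner_Integration.integral_nonneg ac_simps)
      also have "\<dots> = (\<integral>\<^sup>+s. ennreal (\<integral>t. f (t + s) \<partial>\<mu>) * ennreal (g s) \<partial>\<mu>) * ennreal (\<integral>t. k t \<partial>\<mu>)"
        using mg by (intro nn_integral_multc) simp
      also have "(\<integral>\<^sup>+s. ennreal (\<integral>t. f (t + s) \<partial>\<mu>) * ennreal (g s) \<partial>\<mu>)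
          = (\<integral>\<^sup>+s. (\<integral>\<^sup>+t. ennreal (f (t + s)) \<partial>\<mu>) * ennreal (g s) \<partial>\<mu>)"
        using cc_pos_nn_integral[OF cc_pos_right_translate[OF f]] by simp
      finally show ?thesis using right_translate_identity[OF g f] cc_pos_nn_integral[OF k] by simp
    qed
    show "(\<integral>\<^sup>+s. ennreal ((\<integral>t. f (t + s) \<partial>\<mu>) * (\<integral>t. k t \<partial>\<mu>)) * ennreal (g s) \<partial>\<mu>)
        = (\<integral>\<^sup>+s. ennreal ((\<integral>t. k (t + s) \<partial>\<mu>) * (\<integral>t. f t \<partial>\<mu>)) * ennreal (g s) \<partial>\<mu>)"
      unfolding *[OF f k] *[OF k f] by (simp add: ac_simps)
  qed
  show ?thesis using le[OF f k] le[OF k f] by simp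
qed

text \<open>
  The passage from functions to sets: for compact \<open>A\<close> compare with Urysohn functions and use outer
  regularity, then take suprema for open \<open>A\<close> and infima for Borel \<open>A\<close>.
\<close>
lemma right_translate_emeasure_ge:
  assumes c: "c \<ge> 0" and ge: "\<And>k :: 'a \<Rightarrow> real. k \<in> cc_pos \<Longrightarrow> c * (\<integral>t. k t \<partial>\<mu>) \<le> (\<integral>t. k (t + s) \<partial>\<mu>)"
    and A: "A \<in> sets borel"
  shows "ennreal c * emeasure \<mu> A \<le> emeasure \<mu> ((\<lambda>t. t + s) -` A)"
proof -
  have vb: "(\<lambda>t. t + s) -` B \<in> sets borel" if "B \<in> sets borel" for B :: "'a set" and s
    using measurable_sets[OF measurable_translate(2)[of s], of B] that by (simp add: sets_eq_borel)
  have comp: "ennreal c * emeasure \<mu> K \<le> emeasure \<mu> ((\<lambda>t. t + s) -` K)" if K: "compact K" for K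
  proof -
    have K': "compact ((\<lambda>t. t + s) -` K)" by (rule compact_right_translate_vimage[OF K])
    have "ennreal c * emeasure \<mu> K \<le> emeasure \<mu> U" if U: "open U" "(\<lambda>t. t + s) -` K \<subseteq> U" for U
    proof -
      obtain k where k: "k \<in> cc_pos" "\<And>x. k x \<le> 1" "\<And>x. x \<in> (\<lambda>t. t + s) -` K \<Longrightarrow> k x = 1" "\<And>x. x \<notin> U \<Longrightarrow> k x = 0"
        using urysohn_cc[OF K' U] by blast
      have k': "(\<lambda>t. k (t + - s)) \<in> cc_pos" by (rule cc_pos_right_translate[OF k(1)])
      have kpos: "0 \<le> k x" for x using k(1) by (auto simp: cc_pos_def)
      have "ennreal c * emeasure \<mu> K = ennreal c * (\<integral>\<^sup>+x. indicator K x \<partial>\<mu>)" using K by simp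
      also have "\<dots> \<le> ennreal c * (\<integral>\<^sup>+x. ennreal (k (x + - s)) \<partial>\<mu>)"
        using k(3) by (intro mult_left_mono nn_integral_mono) (auto split: split_indicator)
      also have "\<dots> = ennreal (c * (\<integral>x. k (x + - s) \<partial>\<mu>))"
        using c kpos unfolding cc_pos_nn_integral[OF k'] by (simp add: ennreal_mult Bochner_Integration.integral_nonneg)
      also have "\<dots> \<le> ennreal (\<integral>x. k x \<partial>\<mu>)"
        using ge[OF k'] by (intro ennreal_leI) (simp add: add.assoc)
      also have "\<dots> = (\<integral>\<^sup>+x. ennreal (k x) \<partial>\<mu>)" using cc_pos_nn_integral[OF k(1)] by simp
      also have "\<dots> \<le> (\<integral>\<^sup>+x. indicator U x \<partial>\<mu>)"
        using k(2,4) by (intro nn_integral_mono) (auto split: split_indicator)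
      also have "\<dots> = emeasure \<mu> U" using U by simp
      finally show ?thesis .
    qed
    then show ?thesis
      unfolding outer[OF vb[of K s, OF borel_closed[OF compact_imp_closed[OF K]]]] by (intro INF_greatest) auto
  qed
  have opn: "ennreal c * emeasure \<mu> U \<le> emeasure \<mu> ((\<lambda>t. t + s) -` U)" if U: "open U" for U
  proof -
    have "ennreal c * emeasure \<mu> U = (SUP K\<in>{K. compact K \<and> K \<subseteq> U}. ennreal c * emeasure \<mu> K)"
      unfolding inner[OF U] by (rule SUP_mult_left_ennreal)
    also have "\<dots> \<le> emeasure \<mu> ((\<lambda>t. t + s) -` U)"
    proof (rule SUP_least, clarify)
      fix K assume K: "compact K" "K \<subseteq> U"
      show "ennreal c * emeasure \<mu> K \<le> emeasure \<mu> ((\<lambda>t. t + s) -` U)"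
        using comp[OF K(1)] K U open_translate_vimage(1)[OF U, of s]
        by (elim order_trans) (intro emeasure_mono, auto)
    qed
    finally show ?thesis .
  qed
  show ?thesis
    unfolding outer[OF vb[OF A, of s]]
  proof (rule INF_greatest, clarify)
    fix V assume V: "open V" "(\<lambda>t. t + s) -` A \<subseteq> V"
    define U where "U = (\<lambda>t. t + - s) -` V"
    have U: "open U" unfolding U_def by (rule open_translate_vimage(1)[OF V(1)])
    have "A \<subseteq> U"
    proof
      fix a assume "a \<in> A"
      then have "a + - s \<in> (\<lambda>t. t + s) -` A" by (simp add: add.assoc)
      then show "a \<in> U" using V(2) by (auto simp: U_def)
    qed
    then have "ennreal c * emeasure \<mu> A \<le> ennreal c * emeasure \<mu> U"
      using U by (intro mult_left_mono emeasure_mono) auto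
    also have "\<dots> \<le> emeasure \<mu> ((\<lambda>t. t + s) -` U)" by (rule opn[OF U])
    also have "(\<lambda>t. t + s) -` U = V" by (auto simp: U_def add.assoc)
    finally show "ennreal c * emeasure \<mu> A \<le> emeasure \<mu> V" .
  qed
qed

text \<open>
  \<open>\<Delta> s\<close> is the ratio of \<open>\<integral> k (t + s) dt\<close> and \<open>\<integral> k t dt\<close> for one fixed \<open>k\<close>; by \<open>right_translate_ratio\<close> every
  other \<open>k\<close> gives the same ratio. A lower bound for translated sets is what the estimates of slices
  and the invariance of null sets rest on.
\<close>
lemma modular_function:
  obtains \<Delta> :: "'a \<Rightarrow> real" where "continuous_on UNIV \<Delta>" "\<And>s. \<Delta> s > 0" "\<Delta> 0 = 1"
    "\<And>s A. A \<in> sets borel \<Longrightarrow> ennreal (\<Delta> s) * emeasure \<mu> A \<le> emeasure \<mu> ((\<lambda>t. t + s) -` A)"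
proof -
  obtain k where k: "k \<in> cc_pos" "\<And>x. k x \<le> 1" "\<And>x. x \<in> {0::'a} \<Longrightarrow> k x = 1" "\<And>x. x \<notin> UNIV \<Longrightarrow> k x = 0"
    using urysohn_cc[of "{0::'a}" UNIV] by auto
  have pos: "(\<integral>t. k t \<partial>\<mu>) > 0" by (rule cc_pos_integral_positive[OF k(1), of 0]) (simp add: k(3))
  have pos': "(\<integral>t. k (t + s) \<partial>\<mu>) > 0" for s
    by (rule cc_pos_integral_positive[OF cc_pos_right_translate[OF k(1)], of "- s"]) (simp add: k(3))
  define \<Delta> where "\<Delta> s = (\<integral>t. k (t + s) \<partial>\<mu>) / (\<integral>t. k t \<partial>\<mu>)" for s
  show ?thesis
  proof
    show "continuous_on UNIV \<Delta>"
      unfolding \<Delta>_def using pos continuous_right_translate_integral[OF k(1)]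
      by (intro continuous_intros) auto
    show D: "\<Delta> s > 0" for s using pos pos' by (simp add: \<Delta>_def)
    show "\<Delta> 0 = 1" using pos by (simp add: \<Delta>_def)
    show "ennreal (\<Delta> s) * emeasure \<mu> A \<le> emeasure \<mu> ((\<lambda>t. t + s) -` A)" if "A \<in> sets borel" for s A
    proof (rule right_translate_emeasure_ge[OF _ _ that])
      show "0 \<le> \<Delta> s" using D[of s] by simp
      show "\<Delta> s * (\<integral>t. f t \<partial>\<mu>) \<le> (\<integral>t. f (t + s) \<partial>\<mu>)" if "f \<in> cc_pos" for f
        using right_translate_ratio[OF that k(1), of s] pos by (simp add: \<Delta>_def field_simps)
    qed
  qed
qed

text \<open>
  The bound by the modular function at \<open>- s\<close>, applied to the translated set, bounds its measure by
  that of \<open>B\<close>.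
\<close>
lemma null_sets_right_translate:
  assumes B: "B \<in> null_sets \<mu>"
  shows "(\<lambda>t. t + s) -` B \<in> null_sets \<mu>"
proof -
  obtain \<Delta> :: "'a \<Rightarrow> real" where D: "\<And>s. \<Delta> s > 0"
    "\<And>s A. A \<in> sets borel \<Longrightarrow> ennreal (\<Delta> s) * emeasure \<mu> A \<le> emeasure \<mu> ((\<lambda>t. t + s) -` A)"
    using modular_function by metis
  have m: "(\<lambda>t. t + s) -` B \<in> sets \<mu>"
    using measurable_sets[OF measurable_translate(2)[of s], of B] B by auto
  have "(\<lambda>t. t + - s) -` ((\<lambda>t. t + s) -` B) = B" by (auto simp: add.assoc)
  then have "ennreal (\<Delta> (- s)) * emeasure \<mu> ((\<lambda>t. t + s) -` B) \<le> 0"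
    using D(2)[of "(\<lambda>t. t + s) -` B" "- s"] m B by (auto simp: sets_eq_borel)
  then show ?thesis using D(1)[of "- s"] m by (auto simp: null_sets_def)
qed

end

section \<open>Density of continuous functions in the \<open>\<sigma>\<close>-weak topology\<close>

lemma linfty_pos_subset: "linfty_pos \<mu> \<subseteq> linfty \<mu>"
  by (auto simp: linfty_pos_def)

lemma topspace_sigma_weak: "topspace (sigma_weak \<mu>) = linfty \<mu>"
  unfolding sigma_weak_def topspace_pullback_topology by (auto simp: PiE_iff)

text \<open>
  The \<open>\<sigma>\<close>-weak topology in the form in which it is used: a neighbourhood of \<open>f\<close> contains all \<open>g\<close> whose
  pairings with finitely many \<open>\<omega>\<close> are close to those of \<open>f\<close>.
\<close>
lemma sigma_weak_basic_nbhd: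
  assumes T: "openin (sigma_weak \<mu>) T" and f: "f \<in> T"
  obtains \<Omega> e where "finite \<Omega>" "\<Omega> \<subseteq> lone \<mu>" "e > 0"
    "\<And>g. g \<in> linfty \<mu> \<Longrightarrow> (\<And>\<omega>. \<omega> \<in> \<Omega> \<Longrightarrow> dist (\<integral>x. g x * \<omega> x \<partial>\<mu>) (\<integral>x. f x * \<omega> x \<partial>\<mu>) < e) \<Longrightarrow> g \<in> T"
proof -
  let ?E = "\<lambda>f. \<lambda>\<omega>\<in>lone \<mu>. \<integral>x. f x * \<omega> x \<partial>\<mu>"
  obtain U where U: "openin (product_topology (\<lambda>_. euclidean) (lone \<mu>)) U" "T = ?E -` U \<inter> linfty \<mu>"
    using T unfolding sigma_weak_def openin_pullback_topology by blast
  have "?E f \<in> U" using f U(2) by auto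
  with U(1) have "\<exists>X. finite {\<omega>\<in>lone \<mu>. X \<omega> \<noteq> topspace (euclidean :: complex topology)} \<and>
      (\<forall>\<omega>\<in>lone \<mu>. openin euclidean (X \<omega>)) \<and> ?E f \<in> Pi\<^sub>E (lone \<mu>) X \<and> Pi\<^sub>E (lone \<mu>) X \<subseteq> U"
    unfolding openin_product_topology_alt by (rule bspec)
  then obtain X where XX: "finite {\<omega>\<in>lone \<mu>. X \<omega> \<noteq> topspace (euclidean :: complex topology)} \<and>
      (\<forall>\<omega>\<in>lone \<mu>. openin euclidean (X \<omega>)) \<and> ?E f \<in> Pi\<^sub>E (lone \<mu>) X \<and> Pi\<^sub>E (lone \<mu>) X \<subseteq> U" ..
  have X: "finite {\<omega>\<in>lone \<mu>. X \<omega> \<noteq> UNIV}" "Pi\<^sub>E (lone \<mu>) X \<subseteq> U"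
    using XX by auto
  have Xo: "open (X \<omega>)" "(\<integral>x. f x * \<omega> x \<partial>\<mu>) \<in> X \<omega>" if "\<omega> \<in> lone \<mu>" for \<omega>
    using XX that PiE_mem[of "?E f" "lone \<mu>" X \<omega>] by auto
  define \<Omega> where "\<Omega> = {\<omega>\<in>lone \<mu>. X \<omega> \<noteq> UNIV}"
  have fin: "finite \<Omega>" using X(1) by (simp add: \<Omega>_def)
  have "\<exists>r>0. \<forall>z. dist z (\<integral>x. f x * \<omega> x \<partial>\<mu>) < r \<longrightarrow> z \<in> X \<omega>" if "\<omega> \<in> \<Omega>" for \<omega>
  proof -
    have "open (X \<omega>)" "(\<integral>x. f x * \<omega> x \<partial>\<mu>) \<in> X \<omega>"
      using Xo that by (auto simp: \<Omega>_def)
    then show ?thesis unfolding open_dist by blast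
  qed
  then obtain r where r: "\<And>\<omega>. \<omega> \<in> \<Omega> \<Longrightarrow> r \<omega> > 0"
    "\<And>\<omega> z. \<omega> \<in> \<Omega> \<Longrightarrow> dist z (\<integral>x. f x * \<omega> x \<partial>\<mu>) < r \<omega> \<Longrightarrow> z \<in> X \<omega>"
    by metis
  define e where "e = Min (insert 1 (r ` \<Omega>))"
  show ?thesis
  proof
    show "finite \<Omega>" "\<Omega> \<subseteq> lone \<mu>" using fin by (auto simp: \<Omega>_def)
    show "e > 0" using fin r(1) by (auto simp: e_def)
    fix g assume g: "g \<in> linfty \<mu>"
      and gf: "\<And>\<omega>. \<omega> \<in> \<Omega> \<Longrightarrow> dist (\<integral>x. g x * \<omega> x \<partial>\<mu>) (\<integral>x. f x * \<omega> x \<partial>\<mu>) < e"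
    have "(\<integral>x. g x * \<omega> x \<partial>\<mu>) \<in> X \<omega>" if "\<omega> \<in> lone \<mu>" for \<omega>
    proof (cases "\<omega> \<in> \<Omega>")
      case True
      then have "e \<le> r \<omega>" using fin by (auto simp: e_def)
      then show ?thesis using r(2)[OF True] gf[OF True] by simp
    next
      case False
      then show ?thesis using that by (simp add: \<Omega>_def)
    qed
    then have "?E g \<in> Pi\<^sub>E (lone \<mu>) X" by simp
    then have "?E g \<in> U" using X(2) by blast
    then show "g \<in> T" using g U(2) by auto
  qed
qed

text \<open>
  The set \<open>{x. \<omega> x \<noteq> 0}\<close> is a countable union of sets of finite measure, on each of which \<open>P\<close> holds
  almost everywhere. Hence pairings with \<open>L\<^sup>1\<close> do not see locally null sets.
\<close>
lemma locally_ae_integrable: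
  fixes \<omega> :: "'a \<Rightarrow> complex"
  assumes P: "locally_ae \<mu> P" and \<omega>: "integrable \<mu> \<omega>"
  shows "AE x in \<mu>. \<omega> x \<noteq> 0 \<longrightarrow> P x"
proof -
  define A where "A m = {x \<in> space \<mu>. inverse (real (Suc m)) \<le> norm (\<omega> x)}" for m
  have [measurable]: "\<omega> \<in> borel_measurable \<mu>" using \<omega> by auto
  have A: "A m \<in> sets \<mu>" for m unfolding A_def by measurable
  have "emeasure \<mu> (A m) < \<infinity>" for m
  proof -
    have "(\<integral>\<^sup>+x. ennreal (norm (\<omega> x)) \<partial>\<mu>) < \<infinity>" using \<omega> by (simp add: integrable_iff_bounded)
    from finite_superlevel_set[OF _ this, of "inverse (real (Suc m))"]
    show ?thesis by (simp add: A_def)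
  qed
  then have "AE x in \<mu>. \<forall>m. x \<in> A m \<longrightarrow> P x"
    unfolding AE_all_countable using P A by (auto simp: locally_ae_def)
  with AE_space show ?thesis
  proof eventually_elim
    case (elim x)
    show ?case
    proof
      assume "\<omega> x \<noteq> 0"
      then obtain m where "inverse (real (Suc m)) < norm (\<omega> x)"
        using reals_Archimedean[of "norm (\<omega> x)"] by auto
      then have "x \<in> A m" using elim by (auto simp: A_def)
      then show "P x" using elim by blast
    qed
  qed
qed

context radon_measure
begin

lemma cc_pos_linfty_pos:
  assumes k: "k \<in> cc_pos"
  shows "(\<lambda>x. complex_of_real (k x)) \<in> linfty_pos \<mu>"
proof -
  have k': "continuous_on UNIV k" "\<And>x. 0 \<le> k x" using k by (auto simp: cc_pos_def)
  obtain B where "\<And>x. \<bar>k x\<bar> \<le> B" using cc_pos_bounded[OF k] by blast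
  then have "locally_ae \<mu> (\<lambda>x. norm (complex_of_real (k x)) \<le> B)"
    unfolding locally_ae_def by simp
  moreover have "(\<lambda>x. complex_of_real (k x)) \<in> borel_measurable \<mu>"
    using measurable_continuous[OF k'(1)] by simp
  ultimately show ?thesis
    using k'(2) by (auto simp: linfty_pos_def linfty_def locally_ae_def complex_nonneg_Reals_iff)
qed

lemma cc_pos_scaled_sum:
  assumes "f \<in> cc_pos" "g \<in> cc_pos" "c \<ge> 0"
  shows "(\<lambda>x. f x + c * g x) \<in> (cc_pos :: ('a \<Rightarrow> real) set)"
proof -
  obtain K L where "compact K" "\<And>x. x \<notin> K \<Longrightarrow> f x = 0" "compact L" "\<And>x. x \<notin> L \<Longrightarrow> g x = 0"
    using assms by (auto simp: cc_pos_def)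
  then show ?thesis
    using assms unfolding cc_pos_def
    by (auto intro!: continuous_intros exI[of _ "K \<union> L"])
qed

text \<open>
  Approximation in \<open>L\<^sup>1\<close> of the finite measure with density \<open>\<eta>\<close>. Regularity is available for \<open>\<mu>\<close>, and
  only on sets of finite measure, so the argument is run on a set \<open>B n\<close> of finite \<open>\<mu>\<close>-measure on which
  \<open>\<eta>\<close> is bounded and outside of which \<open>\<eta>\<close> has small integral.
\<close>
lemma cc_pos_approx_indicator:
  assumes A: "A \<in> sets \<mu>" and \<eta>: "integrable \<mu> \<eta>" "\<And>x. 0 \<le> (\<eta> x :: real)" and e: "e > 0"
  shows "\<exists>k\<in>cc_pos. (\<forall>x. k x \<le> 1) \<and> (\<integral>x. \<bar>indicator A x - k x\<bar> * \<eta> x \<partial>\<mu>) < e"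
proof -
  have [measurable]: "\<eta> \<in> borel_measurable \<mu>" "A \<in> sets \<mu>" using \<eta> A by auto
  define B where "B n = {x. inverse (real (Suc n)) \<le> \<eta> x \<and> \<eta> x \<le> real (Suc n)}" for n
  have B[measurable]: "B n \<in> sets \<mu>" for n
  proof -
    have "B n = {x \<in> space \<mu>. inverse (real (Suc n)) \<le> \<eta> x \<and> \<eta> x \<le> real (Suc n)}" by (simp add: B_def)
    also have "\<dots> \<in> sets \<mu>" by measurable
    finally show ?thesis .
  qed
  have "(\<lambda>n. \<integral>x. indicator (- B n) x * \<eta> x \<partial>\<mu>) \<longlonglongrightarrow> (\<integral>x. 0 \<partial>\<mu>)"
  proof (rule integral_dominated_convergence[where w = \<eta>])
    have "(\<lambda>n. indicator (- B n) x * \<eta> x) \<longlonglongrightarrow> 0" for x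
    proof (cases "\<eta> x = 0")
      case False
      then have "\<eta> x > 0" using \<eta>(2)[of x] by simp
      then obtain m where m: "inverse (real (Suc m)) < \<eta> x" using reals_Archimedean by blast
      obtain m' where m': "\<eta> x \<le> real m'" using real_arch_simple by blast
      have "x \<in> B n" if "n \<ge> max m m'" for n
      proof -
        have "inverse (real (Suc n)) \<le> inverse (real (Suc m))" using that by (intro le_imp_inverse_le) auto
        moreover have "real m' \<le> real (Suc n)" using that by simp
        ultimately have "inverse (real (Suc n)) \<le> \<eta> x" "\<eta> x \<le> real (Suc n)" using m m' by linarith+
        then show ?thesis unfolding B_def by blast
      qed
      then have "\<forall>\<^sub>F n in sequentially. indicator (- B n) x * \<eta> x = 0"
        unfolding eventually_sequentially by (intro exI[of _ "max m m'"]) auto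
      then show ?thesis by (rule tendsto_eventually)
    qed simp
    then show "AE x in \<mu>. (\<lambda>n. indicator (- B n) x * \<eta> x) \<longlonglongrightarrow> 0" by simp
    show "AE x in \<mu>. norm (indicator (- B n) x * \<eta> x) \<le> \<eta> x" for n
      using \<eta>(2) by (auto split: split_indicator)
  qed (use \<eta> B in \<open>auto intro!: borel_measurable_times borel_measurable_indicator simp: Compl_eq_Diff_UNIV sets.Diff[of UNIV \<mu>, simplified]\<close>)
  then have "(\<lambda>n. \<integral>x. indicator (- B n) x * \<eta> x \<partial>\<mu>) \<longlonglongrightarrow> 0" by simp
  from order_tendstoD(2)[OF this, of "e / 2"] obtain n where n: "(\<integral>x. indicator (- B n) x * \<eta> x \<partial>\<mu>) < e / 2"
    using e by (auto simp: eventually_sequentially)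
  have finB: "emeasure \<mu> (B n) < \<infinity>"
  proof -
    have fin\<eta>: "(\<integral>\<^sup>+x. ennreal (norm (\<eta> x)) \<partial>\<mu>) < \<infinity>" using \<eta> by (simp add: integrable_iff_bounded)
    let ?A = "{x \<in> space \<mu>. ennreal (inverse (real (Suc n))) \<le> ennreal (norm (\<eta> x))}"
    have "B n \<subseteq> ?A" by (auto simp: B_def intro!: ennreal_leI)
    moreover have "?A \<in> sets \<mu>" by measurable
    ultimately have "emeasure \<mu> (B n) \<le> emeasure \<mu> ?A" by (rule emeasure_mono)
    also have "\<dots> < \<infinity>" by (rule finite_superlevel_set[OF _ fin\<eta>]) auto
    finally show ?thesis .
  qed
  define d where "d = e / (2 * real (Suc n))"
  have d: "d > 0" using e by (simp add: d_def)
  have AB: "A \<inter> B n \<in> sets borel" using sets.Int[OF A B] by (simp add: sets_eq_borel)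
  have finAB: "emeasure \<mu> (A \<inter> B n) < \<infinity>" using emeasure_mono[of "A \<inter> B n" "B n" \<mu>] finB B by (auto intro: le_less_trans)
  obtain K U where KU: "compact K" "open U" "K \<subseteq> A \<inter> B n" "A \<inter> B n \<subseteq> U" "emeasure \<mu> (U - K) < ennreal d"
    using inner_outer_approx[OF AB finAB d] .
  have mUK: "measure \<mu> (U - K) < d" and finUK: "emeasure \<mu> (U - K) < \<infinity>"
  proof -
    show fin: "emeasure \<mu> (U - K) < \<infinity>"
      using KU(5) by (metis infinity_ennreal_def ennreal_less_top order_less_trans)
    then have "emeasure \<mu> (U - K) = ennreal (measure \<mu> (U - K))"
      by (intro emeasure_eq_ennreal_measure) auto
    then show "measure \<mu> (U - K) < d" using KU(5) d by (simp add: ennreal_less_iff)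
  qed
  have [measurable]: "U - K \<in> sets \<mu>" using KU by (auto intro!: sets.Diff)
  have "K \<subseteq> U" using KU by blast
  then obtain k where k: "k \<in> cc_pos" "\<And>x. k x \<le> 1" "\<And>x. x \<in> K \<Longrightarrow> k x = 1" "\<And>x. x \<notin> U \<Longrightarrow> k x = 0"
    using urysohn_cc[OF KU(1,2)] by blast
  have k0: "0 \<le> k x" for x using k(1) by (auto simp: cc_pos_def)
  have [measurable]: "k \<in> borel_measurable \<mu>" using k(1) measurable_continuous by (auto simp: cc_pos_def)
  have [measurable]: "- B n \<in> sets \<mu>" using sets.Diff[OF sets.top B[of n]] by (simp add: Compl_eq_Diff_UNIV)
  \<comment> \<open>On \<open>B n\<close>, the functions \<open>k\<close> and \<open>indicator A\<close> differ only on \<open>U - K\<close>, and there \<open>\<eta> \<le> Suc n\<close>.\<close>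
  have ptw: "\<bar>indicator A x - k x\<bar> * \<eta> x \<le> indicator (- B n) x * \<eta> x + real (Suc n) * indicator (U - K) x" for x
  proof (cases "x \<in> B n")
    case False
    have "\<bar>indicator A x - k x\<bar> * \<eta> x \<le> 1 * \<eta> x"
      using k0[of x] k(2)[of x] \<eta>(2) by (intro mult_right_mono) (auto split: split_indicator)
    then show ?thesis using False by (auto split: split_indicator)
  next
    case True
    show ?thesis
    proof (cases "x \<in> U - K")
      case True
      have "\<bar>indicator A x - k x\<bar> * \<eta> x \<le> 1 * real (Suc n)"
        using k0[of x] k(2)[of x] \<eta>(2) \<open>x \<in> B n\<close>
        by (intro mult_mono) (auto simp: B_def split: split_indicator)
      then show ?thesis using True \<open>x \<in> B n\<close> by simp
    next
      case False
      then have "indicator A x = k x" using True KU k(3,4) by (auto split: split_indicator)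
      then show ?thesis using True False by simp
    qed
  qed
  have int1: "integrable \<mu> (\<lambda>x. indicator (- B n) x * \<eta> x)"
    using integrable_mult_indicator[OF \<open>- B n \<in> sets \<mu>\<close> \<eta>(1)] by simp
  have int2: "integrable \<mu> (\<lambda>x. real (Suc n) * indicator (U - K) x)" using finUK by simp
  have "(\<integral>x. \<bar>indicator A x - k x\<bar> * \<eta> x \<partial>\<mu>) \<le> (\<integral>x. indicator (- B n) x * \<eta> x + real (Suc n) * indicator (U - K) x \<partial>\<mu>)"
  proof (rule integral_mono)
    show "integrable \<mu> (\<lambda>x. \<bar>indicator A x - k x\<bar> * \<eta> x)"
    proof (rule Bochner_Integration.integrable_bound[OF \<eta>(1)])
      show "AE x in \<mu>. norm (\<bar>indicator A x - k x\<bar> * \<eta> x) \<le> norm (\<eta> x)"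
      proof (rule AE_I2)
        fix x
        have "\<bar>indicator A x - k x\<bar> * \<eta> x \<le> 1 * \<eta> x"
          using k0[of x] k(2)[of x] \<eta>(2) by (intro mult_right_mono) (auto split: split_indicator)
        then show "norm (\<bar>indicator A x - k x\<bar> * \<eta> x) \<le> norm (\<eta> x)" using \<eta>(2)[of x] by (simp add: abs_mult)
      qed
    qed measurable
    show "integrable \<mu> (\<lambda>x. indicator (- B n) x * \<eta> x + real (Suc n) * indicator (U - K) x)"
      using int1 int2 by simp
  qed (rule ptw)
  also have "\<dots> = (\<integral>x. indicator (- B n) x * \<eta> x \<partial>\<mu>) + real (Suc n) * measure \<mu> (U - K)"
    using int1 int2 by (subst Bochner_Integration.integral_add) auto
  also have "\<dots> < e / 2 + real (Suc n) * d"
    using n mUK by (intro add_strict_mono) auto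
  also have "\<dots> = e"
  proof -
    have "real (Suc n) * d = e / 2" unfolding d_def by (simp del: of_nat_Suc)
    then show ?thesis by simp
  qed
  finally show ?thesis using k by blast
qed

lemma integrable_bounded_times:
  fixes f \<eta> :: "'a \<Rightarrow> real"
  assumes [measurable]: "f \<in> borel_measurable \<mu>" and f: "\<And>x. \<bar>f x\<bar> \<le> C" and \<eta>: "integrable \<mu> \<eta>"
  shows "integrable \<mu> (\<lambda>x. f x * \<eta> x)"
proof (rule Bochner_Integration.integrable_bound[of _ "\<lambda>x. C * \<eta> x"])
  show "integrable \<mu> (\<lambda>x. C * \<eta> x)" using \<eta> by simp
  have "\<bar>f x\<bar> * \<bar>\<eta> x\<bar> \<le> \<bar>C\<bar> * \<bar>\<eta> x\<bar>" for x using f[of x] by (intro mult_right_mono) auto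
  then show "AE x in \<mu>. norm (f x * \<eta> x) \<le> norm (C * \<eta> x)" by (simp add: abs_mult)
qed (use \<eta> in measurable)

text \<open>
  Induction on the number of horizontal layers of height \<open>d\<close>: subtract \<open>d\<close> wherever \<open>f \<ge> d\<close>, and approximate
  the indicator of that set. In the lowest layer \<open>0\<close> is good enough, at the cost of \<open>d * \<integral> \<eta>\<close>.
\<close>
lemma cc_pos_approx_layers:
  assumes \<eta>: "integrable \<mu> \<eta>" "\<And>x. 0 \<le> (\<eta> x :: real)" and d: "d > 0"
    and f: "f \<in> borel_measurable \<mu>" "\<And>x. 0 \<le> f x" "\<And>x. f x \<le> real (Suc N) * d" and e: "e > 0"
  shows "\<exists>k\<in>cc_pos. (\<integral>x. \<bar>f x - k x\<bar> * \<eta> x \<partial>\<mu>) \<le> d * (\<integral>x. \<eta> x \<partial>\<mu>) + e"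
  using f e
proof (induction N arbitrary: f e)
  case 0
  have "(\<integral>x. \<bar>f x - 0\<bar> * \<eta> x \<partial>\<mu>) \<le> (\<integral>x. d * \<eta> x \<partial>\<mu>)"
  proof (rule integral_mono)
    show "integrable \<mu> (\<lambda>x. \<bar>f x - 0\<bar> * \<eta> x)"
      using 0 \<eta> by (intro integrable_bounded_times[of _ d]) auto
    show "\<bar>f x - 0\<bar> * \<eta> x \<le> d * \<eta> x" for x using 0(2,3)[of x] \<eta>(2)[of x] by (intro mult_right_mono) auto
  qed (use \<eta> in auto)
  then show ?case using 0(4) by (intro bexI[of _ "\<lambda>_. 0"]) (auto simp: cc_pos_def)
next
  case (Suc N)
  define A where "A = {x \<in> space \<mu>. d \<le> f x}"
  note [measurable] = Suc.prems(1)
  have A[measurable]: "A \<in> sets \<mu>" unfolding A_def by measurable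
  define g where "g x = f x - d * indicator A x" for x
  have [measurable]: "g \<in> borel_measurable \<mu>" unfolding g_def by measurable
  have g: "0 \<le> g x" "g x \<le> real (Suc N) * d" for x
  proof -
    show "0 \<le> g x" using Suc.prems(2)[of x] by (auto simp: g_def A_def split: split_indicator)
    have "d \<le> real (Suc N) * d" using d by simp
    then show "g x \<le> real (Suc N) * d"
      using Suc.prems(3)[of x] by (auto simp: g_def A_def algebra_simps split: split_indicator)
  qed
  obtain k where k: "k \<in> cc_pos" "(\<integral>x. \<bar>g x - k x\<bar> * \<eta> x \<partial>\<mu>) \<le> d * (\<integral>x. \<eta> x \<partial>\<mu>) + e / 2"
    using Suc.IH[of g "e / 2"] g Suc.prems(4) by auto
  obtain h where h: "h \<in> cc_pos" "(\<integral>x. \<bar>indicator A x - h x\<bar> * \<eta> x \<partial>\<mu>) < e / (2 * d)"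
    using cc_pos_approx_indicator[OF A \<eta>, of "e / (2 * d)"] Suc.prems(4) d by auto
  obtain Bk Bh where Bk: "\<And>x. \<bar>k x\<bar> \<le> Bk" and Bh: "\<And>x. \<bar>h x\<bar> \<le> Bh"
    using cc_pos_bounded k(1) h(1) by metis
  have [measurable]: "k \<in> borel_measurable \<mu>" "h \<in> borel_measurable \<mu>"
    using k(1) h(1) measurable_continuous by (auto simp: cc_pos_def)
  have gb: "\<bar>g x\<bar> \<le> real (Suc N) * d" for x using g[of x] by simp
  have i1: "integrable \<mu> (\<lambda>x. \<bar>g x - k x\<bar> * \<eta> x)"
  proof (rule integrable_bounded_times[OF _ _ \<eta>(1)])
    show "\<bar>\<bar>g x - k x\<bar>\<bar> \<le> real (Suc N) * d + Bk" for x
      using abs_triangle_ineq4[of "g x" "k x"] gb[of x] Bk[of x] unfolding abs_idempotent by linarith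
  qed measurable
  have i2: "integrable \<mu> (\<lambda>x. \<bar>indicator A x - h x\<bar> * \<eta> x)"
  proof (rule integrable_bounded_times[OF _ _ \<eta>(1)])
    show "\<bar>\<bar>indicator A x - h x\<bar>\<bar> \<le> 1 + Bh" for x
      using Bh[of x] by (auto split: split_indicator)
  qed measurable
  have ptw: "\<bar>f x - (k x + d * h x)\<bar> * \<eta> x \<le> \<bar>g x - k x\<bar> * \<eta> x + d * (\<bar>indicator A x - h x\<bar> * \<eta> x)" for x
  proof -
    have "f x - (k x + d * h x) = (g x - k x) + d * (indicator A x - h x)"
      by (simp add: g_def algebra_simps)
    then have "\<bar>f x - (k x + d * h x)\<bar> \<le> \<bar>g x - k x\<bar> + d * \<bar>indicator A x - h x\<bar>"
      using d by (metis abs_triangle_ineq abs_mult abs_of_pos)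
    from mult_right_mono[OF this \<eta>(2)[of x]] show ?thesis by (simp add: algebra_simps)
  qed
  have "(\<integral>x. \<bar>f x - (k x + d * h x)\<bar> * \<eta> x \<partial>\<mu>)
     \<le> (\<integral>x. \<bar>g x - k x\<bar> * \<eta> x + d * (\<bar>indicator A x - h x\<bar> * \<eta> x) \<partial>\<mu>)"
  proof (rule integral_mono)
    have i12: "integrable \<mu> (\<lambda>x. \<bar>g x - k x\<bar> * \<eta> x + d * (\<bar>indicator A x - h x\<bar> * \<eta> x))"
      using i1 i2 by simp
    then show "integrable \<mu> (\<lambda>x. \<bar>g x - k x\<bar> * \<eta> x + d * (\<bar>indicator A x - h x\<bar> * \<eta> x))" .
    show "integrable \<mu> (\<lambda>x. \<bar>f x - (k x + d * h x)\<bar> * \<eta> x)"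
    proof (rule Bochner_Integration.integrable_bound[OF i12])
      have "0 \<le> \<bar>f x - (k x + d * h x)\<bar> * \<eta> x" for x using \<eta>(2) by simp
      then show "AE x in \<mu>. norm (\<bar>f x - (k x + d * h x)\<bar> * \<eta> x)
          \<le> norm (\<bar>g x - k x\<bar> * \<eta> x + d * (\<bar>indicator A x - h x\<bar> * \<eta> x))"
        using ptw by (intro AE_I2) (metis abs_ge_self abs_of_nonneg order_trans real_norm_def)
    qed (use \<eta> in measurable)
  qed (rule ptw)
  also have "\<dots> = (\<integral>x. \<bar>g x - k x\<bar> * \<eta> x \<partial>\<mu>) + d * (\<integral>x. \<bar>indicator A x - h x\<bar> * \<eta> x \<partial>\<mu>)"
    using i1 i2 by simp
  also have "\<dots> \<le> (d * (\<integral>x. \<eta> x \<partial>\<mu>) + e / 2) + d * (e / (2 * d))"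
    using k(2) h(2) d by (intro add_mono mult_left_mono) auto
  also have "\<dots> = d * (\<integral>x. \<eta> x \<partial>\<mu>) + e" using d by simp
  finally show ?case
    by (intro bexI[of _ "\<lambda>x. k x + d * h x"]) (use cc_pos_scaled_sum[OF k(1) h(1)] d in auto)
qed

lemma cc_pos_approx:
  assumes \<eta>: "integrable \<mu> \<eta>" "\<And>x. 0 \<le> (\<eta> x :: real)"
    and f: "f \<in> borel_measurable \<mu>" "\<And>x. 0 \<le> f x" "\<And>x. f x \<le> C" and e: "e > 0"
  shows "\<exists>k\<in>cc_pos. (\<integral>x. \<bar>f x - k x\<bar> * \<eta> x \<partial>\<mu>) < e"
proof -
  define I where "I = (\<integral>x. \<eta> x \<partial>\<mu>)"
  have I: "I \<ge> 0" using \<eta>(2) by (simp add: I_def Bochner_Integration.integral_nonneg)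
  define d where "d = e / (2 * (I + 1))"
  have d: "d > 0" using e I by (simp add: d_def)
  obtain N where N: "C / d \<le> real N" using real_arch_simple by blast
  have "f x \<le> real (Suc N) * d" for x
  proof -
    have "C \<le> real N * d" using N d by (simp add: field_simps)
    also have "\<dots> \<le> real (Suc N) * d" using d by (intro mult_right_mono) auto
    finally show ?thesis using f(3)[of x] by simp
  qed
  then obtain k where k: "k \<in> cc_pos" "(\<integral>x. \<bar>f x - k x\<bar> * \<eta> x \<partial>\<mu>) \<le> d * I + e / 4"
    using cc_pos_approx_layers[OF \<eta> d f(1,2), of N "e / 4"] e unfolding I_def by auto
  have "d * I \<le> d * (I + 1)" using d by simp
  also have "\<dots> = e / 2" using I by (simp add: d_def field_simps)
  finally have "d * I + e / 4 < e" using e by simp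
  then show ?thesis using k by (auto intro: le_less_trans)
qed

text \<open>
  One \<open>L\<^sup>1\<close> approximation with the density \<open>\<eta> = \<Sum>\<bar>\<omega>\<bar>\<close> serves all \<open>\<omega> \<in> \<Omega>\<close> at once. Locally null sets
  being invisible to the pairings, \<open>f\<close> may be replaced by a bounded nonnegative real function.
\<close>
lemma cc_pos_sigma_weak_approx:
  assumes f: "f \<in> linfty_pos \<mu>" and \<Omega>: "finite \<Omega>" "\<Omega> \<subseteq> lone \<mu>" and e: "e > 0"
  shows "\<exists>k\<in>cc_pos. \<forall>\<omega>\<in>\<Omega>. dist (\<integral>x. complex_of_real (k x) * \<omega> x \<partial>\<mu>) (\<integral>x. f x * \<omega> x \<partial>\<mu>) < e"
proof -
  obtain C where C: "locally_ae \<mu> (\<lambda>x. norm (f x) \<le> C)" and pos: "locally_ae \<mu> (\<lambda>x. f x \<in> \<real>\<^sub>\<ge>\<^sub>0)"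
    and [measurable]: "f \<in> borel_measurable \<mu>"
    using f by (auto simp: linfty_pos_def linfty_def)
  define f' where "f' x = max 0 (min (Re (f x)) C)" for x
  have f'm[measurable]: "f' \<in> borel_measurable \<mu>" unfolding f'_def by measurable
  have f': "0 \<le> f' x" "f' x \<le> max 0 C" for x by (auto simp: f'_def)
  have \<Omega>i: "integrable \<mu> \<omega>" if "\<omega> \<in> \<Omega>" for \<omega> using that \<Omega> by (auto simp: lone_def)
  define \<eta> where "\<eta> x = (\<Sum>\<omega>\<in>\<Omega>. norm (\<omega> x))" for x
  have \<eta>: "integrable \<mu> \<eta>" "\<And>x. 0 \<le> \<eta> x"
    using \<Omega>i unfolding \<eta>_def by (auto intro!: sum_nonneg integrable_norm)
  obtain k where k: "k \<in> cc_pos" "(\<integral>x. \<bar>f' x - k x\<bar> * \<eta> x \<partial>\<mu>) < e"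
    using cc_pos_approx[OF \<eta> f'm f' e] by blast
  obtain Bk where Bk: "\<And>x. \<bar>k x\<bar> \<le> Bk" using cc_pos_bounded[OF k(1)] by blast
  have [measurable]: "k \<in> borel_measurable \<mu>"
    using k(1) measurable_continuous by (auto simp: cc_pos_def)
  have i1: "integrable \<mu> (\<lambda>x. \<bar>f' x - k x\<bar> * \<eta> x)"
  proof (rule integrable_bounded_times[OF _ _ \<eta>(1)])
    show "\<bar>\<bar>f' x - k x\<bar>\<bar> \<le> max 0 C + Bk" for x
      using abs_triangle_ineq4[of "f' x" "k x"] f'[of x] Bk[of x] unfolding abs_idempotent by linarith
  qed measurable
  have bnd: "integrable \<mu> (\<lambda>x. complex_of_real (h x) * \<omega> x)"
    if "\<omega> \<in> \<Omega>" "h \<in> borel_measurable \<mu>" "\<And>x. \<bar>h x\<bar> \<le> B" for \<omega> and h :: "'a \<Rightarrow> real" and B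
  proof (rule Bochner_Integration.integrable_bound)
    show "integrable \<mu> (\<lambda>x. h x * norm (\<omega> x))"
      by (rule integrable_bounded_times[OF that(2,3)]) (use \<Omega>i[OF that(1)] in auto)
    show "(\<lambda>x. complex_of_real (h x) * \<omega> x) \<in> borel_measurable \<mu>"
      using that(2) \<Omega>i[OF that(1)] by auto
  qed (simp add: norm_mult abs_mult)
  have "dist (\<integral>x. complex_of_real (k x) * \<omega> x \<partial>\<mu>) (\<integral>x. f x * \<omega> x \<partial>\<mu>) < e" if \<omega>: "\<omega> \<in> \<Omega>" for \<omega>
  proof -
    have [measurable]: "\<omega> \<in> borel_measurable \<mu>" using \<Omega>i[OF \<omega>] by auto
    have "(\<integral>x. f x * \<omega> x \<partial>\<mu>) = (\<integral>x. complex_of_real (f' x) * \<omega> x \<partial>\<mu>)"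
    proof (rule integral_cong_AE)
      show "AE x in \<mu>. f x * \<omega> x = complex_of_real (f' x) * \<omega> x"
        using locally_ae_integrable[OF C \<Omega>i[OF \<omega>]] locally_ae_integrable[OF pos \<Omega>i[OF \<omega>]]
      proof eventually_elim
        case (elim x)
        show ?case
        proof (cases "\<omega> x = 0")
          case False
          then have "norm (f x) \<le> C" "f x \<in> \<real>\<^sub>\<ge>\<^sub>0" using elim by auto
          then have "complex_of_real (f' x) = f x"
            by (auto simp: f'_def complex_nonneg_Reals_iff complex_eq_iff cmod_eq_Re)
          then show ?thesis by simp
        qed simp
      qed
    qed measurable
    moreover have "integrable \<mu> (\<lambda>x. complex_of_real (k x) * \<omega> x)" by (rule bnd[OF \<omega> _ Bk]) measurable
    moreover have "integrable \<mu> (\<lambda>x. complex_of_real (f' x) * \<omega> x)"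
      by (rule bnd[OF \<omega> f'm, of "max 0 C"]) (use f' in simp)
    ultimately have "dist (\<integral>x. complex_of_real (k x) * \<omega> x \<partial>\<mu>) (\<integral>x. f x * \<omega> x \<partial>\<mu>)
        = norm (\<integral>x. complex_of_real (k x) * \<omega> x - complex_of_real (f' x) * \<omega> x \<partial>\<mu>)"
      by (simp add: dist_norm)
    also have "\<dots> \<le> (\<integral>x. norm (complex_of_real (k x) * \<omega> x - complex_of_real (f' x) * \<omega> x) \<partial>\<mu>)"
      by (rule integral_norm_bound)
    also have "\<dots> \<le> (\<integral>x. \<bar>f' x - k x\<bar> * \<eta> x \<partial>\<mu>)"
    proof (rule integral_mono_AE[OF _ i1])
      show ptw: "AE x in \<mu>. norm (complex_of_real (k x) * \<omega> x - complex_of_real (f' x) * \<omega> x) \<le> \<bar>f' x - k x\<bar> * \<eta> x"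
      proof (rule AE_I2)
        fix x
        have "norm (complex_of_real (k x) * \<omega> x - complex_of_real (f' x) * \<omega> x) = \<bar>f' x - k x\<bar> * norm (\<omega> x)"
          by (metis abs_minus_commute left_diff_distrib norm_mult norm_of_real of_real_diff)
        also have "\<dots> \<le> \<bar>f' x - k x\<bar> * \<eta> x"
          unfolding \<eta>_def using \<Omega>(1) \<omega> by (intro mult_left_mono member_le_sum) auto
        finally show "norm (complex_of_real (k x) * \<omega> x - complex_of_real (f' x) * \<omega> x) \<le> \<bar>f' x - k x\<bar> * \<eta> x" .
      qed
      show "integrable \<mu> (\<lambda>x. norm (complex_of_real (k x) * \<omega> x - complex_of_real (f' x) * \<omega> x))"
        using bnd[OF \<omega> _ Bk] bnd[OF \<omega> f'm, of "max 0 C"] f' by (intro integrable_norm Bochner_Integration.integrable_diff) auto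
    qed
    also have "\<dots> < e" by (rule k(2))
    finally show ?thesis .
  qed
  then show ?thesis using k(1) by blast
qed

lemma cc_pos_sigma_weak_dense:
  assumes "\<And>k. k \<in> cc_pos \<Longrightarrow> (\<lambda>x. complex_of_real (k x)) \<in> S"
  shows "linfty_pos \<mu> \<subseteq> sigma_weak \<mu> closure_of S"
proof
  fix f assume f: "f \<in> linfty_pos \<mu>"
  show "f \<in> sigma_weak \<mu> closure_of S"
    unfolding in_closure_of topspace_sigma_weak
  proof (intro conjI allI impI)
    show "f \<in> linfty \<mu>" using f linfty_pos_subset by blast
    fix T assume T: "f \<in> T \<and> openin (sigma_weak \<mu>) T"
    obtain \<Omega> e where \<Omega>: "finite \<Omega>" "\<Omega> \<subseteq> lone \<mu>" "e > 0" and
      nb: "\<And>g. g \<in> linfty \<mu> \<Longrightarrow> (\<And>\<omega>. \<omega> \<in> \<Omega> \<Longrightarrow> dist (\<integral>x. g x * \<omega> x \<partial>\<mu>) (\<integral>x. f x * \<omega> x \<partial>\<mu>) < e) \<Longrightarrow> g \<in> T"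
      using sigma_weak_basic_nbhd[OF conjunct2[OF T] conjunct1[OF T]] by metis
    obtain k where k: "k \<in> cc_pos"
      "\<And>\<omega>. \<omega> \<in> \<Omega> \<Longrightarrow> dist (\<integral>x. complex_of_real (k x) * \<omega> x \<partial>\<mu>) (\<integral>x. f x * \<omega> x \<partial>\<mu>) < e"
      using cc_pos_sigma_weak_approx[OF f \<Omega>] by blast
    have "(\<lambda>x. complex_of_real (k x)) \<in> T"
      by (rule nb) (use k cc_pos_linfty_pos[OF k(1)] linfty_pos_subset in auto)
    then show "\<exists>y. y \<in> S \<and> y \<in> T" using assms[OF k(1)] by blast
  qed
qed

end

section \<open>Proper homomorphisms give integrable actions\<close>

context radon_measure
begin

text \<open>
  Turns the pairings that occur in \<^const>\<open>is_haar_integral\<close> into integrals of nonnegative functions, to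
  which Tonelli's theorem and monotone convergence apply.
\<close>
lemma nn_integral_pairing:
  fixes h :: "'a \<Rightarrow> real"
  assumes h: "h \<in> borel_measurable \<mu>" "\<And>x. 0 \<le> h x" "\<And>x. h x \<le> B" and \<omega>: "\<omega> \<in> lone_pos \<mu>"
  shows "ennreal (Re (\<integral>x. complex_of_real (h x) * \<omega> x \<partial>\<mu>)) = (\<integral>\<^sup>+x. ennreal (h x) * ennreal (Re (\<omega> x)) \<partial>\<mu>)"
proof -
  have \<omega>i: "integrable \<mu> \<omega>" and pos: "AE x in \<mu>. \<omega> x \<in> \<real>\<^sub>\<ge>\<^sub>0"
    using \<omega> by (auto simp: lone_pos_def lone_def)
  have hB: "\<bar>h x\<bar> \<le> B" for x using h(2,3)[of x] by simp
  have int: "integrable \<mu> (\<lambda>x. complex_of_real (h x) * \<omega> x)"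
  proof (rule Bochner_Integration.integrable_bound)
    show "integrable \<mu> (\<lambda>x. h x * norm (\<omega> x))"
      by (rule integrable_bounded_times[OF h(1) hB]) (use \<omega>i in auto)
    show "(\<lambda>x. complex_of_real (h x) * \<omega> x) \<in> borel_measurable \<mu>" using h(1) \<omega>i by auto
  qed (simp add: norm_mult abs_mult)
  have "Re (\<integral>x. complex_of_real (h x) * \<omega> x \<partial>\<mu>) = (\<integral>x. h x * Re (\<omega> x) \<partial>\<mu>)"
    using integral_Re[OF int] by simp
  also have "ennreal \<dots> = (\<integral>\<^sup>+x. ennreal (h x * Re (\<omega> x)) \<partial>\<mu>)"
  proof (rule nn_integral_eq_integral[symmetric])
    show "integrable \<mu> (\<lambda>x. h x * Re (\<omega> x))"
      by (rule integrable_bounded_times[OF h(1) hB]) (use \<omega>i in auto)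
    show "AE x in \<mu>. 0 \<le> h x * Re (\<omega> x)"
      using pos by eventually_elim (use h(2) in \<open>simp add: complex_nonneg_Reals_iff\<close>)
  qed
  also have "\<dots> = (\<integral>\<^sup>+x. ennreal (h x) * ennreal (Re (\<omega> x)) \<partial>\<mu>)"
    by (simp add: ennreal_mult' h(2))
  finally show ?thesis .
qed

lemma nn_integral_carrier_SUP:
  fixes u w :: "'a \<Rightarrow> ennreal"
  assumes u[measurable]: "u \<in> borel_measurable \<mu>" and w[measurable]: "w \<in> borel_measurable \<mu>"
    and K: "\<And>n::nat. compact (K n)" "incseq K" "AE x in \<mu>. w x \<noteq> 0 \<longrightarrow> x \<in> (\<Union>n. K n)"
  shows "(\<integral>\<^sup>+x. u x * w x \<partial>\<mu>) = (SUP n. \<integral>\<^sup>+x. u x * w x * indicator (K n) x \<partial>\<mu>)"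
proof -
  have [measurable]: "K n \<in> sets \<mu>" for n using K(1) by simp
  have inc: "incseq (\<lambda>n x. u x * w x * indicator (K n) x)"
    using K(2) by (auto simp: incseq_def le_fun_def intro!: mult_left_mono split: split_indicator)
  have "(\<integral>\<^sup>+x. u x * w x \<partial>\<mu>) = (\<integral>\<^sup>+x. (SUP n. u x * w x * indicator (K n) x) \<partial>\<mu>)"
  proof (rule nn_integral_cong_AE, use K(3) in eventually_elim)
    case (elim x)
    show ?case
    proof (cases "w x = 0")
      case False
      then obtain m where "x \<in> K m" using elim by blast
      then have "u x * w x \<le> (SUP n. u x * w x * indicator (K n) x)"
        by (intro SUP_upper2[of m]) auto
      moreover have "(SUP n. u x * w x * indicator (K n) x) \<le> u x * w x"
        by (intro SUP_least) (auto split: split_indicator)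
      ultimately show ?thesis by (rule antisym)
    qed simp
  qed
  also have "\<dots> = (SUP n. \<integral>\<^sup>+x. u x * w x * indicator (K n) x \<partial>\<mu>)"
    by (rule nn_integral_monotone_convergence_SUP[OF inc]) measurable
  finally show ?thesis .
qed

end

text \<open>
  The integral is \<open>\<phi> g = \<integral> k (g + p h) dh\<close>. The interchange of the integrals over \<open>G\<close> and \<open>H\<close> is done
  with \<open>\<omega>\<close> cut off to compact sets \<open>D n\<close> that exhaust its carrier: for \<open>g \<in> D n\<close> the integrand vanishes
  unless \<open>p h \<in> - D n + K\<close>, which by properness confines \<open>h\<close> to a compact set.
\<close>
lemma cc_pos_integrable_element:
  fixes p :: "'h::{topological_group_add,t2_space} \<Rightarrow> 'g::{topological_group_add,t2_space}"
  assumes "left_haar \<mu>" "left_haar \<nu>"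
    and p: "continuous_on UNIV p" and hom: "\<And>x y. p (x + y) = p x + p y"
    and proper: "\<And>C. compact C \<Longrightarrow> compact (p -` C)" and k: "k \<in> cc_pos"
  shows "(\<lambda>x. complex_of_real (k x)) \<in> integrable_elements \<mu> \<nu> p"
proof -
  interpret G: left_haar \<mu> by fact
  interpret H: left_haar \<nu> by fact
  obtain K where k': "continuous_on UNIV k" "\<And>x. 0 \<le> k x" "compact K" "\<And>x. x \<notin> K \<Longrightarrow> k x = 0"
    using k by (auto simp: cc_pos_def)
  obtain B where B: "\<And>x. k x \<le> B" using cc_pos_bounded[OF k] by (meson abs_le_D1)
  define F where "F = (\<lambda>(g, h). k (g + p h))"
  have F: "continuous_on UNIV F"
    unfolding F_def split_beta
    by (rule continuous_on_compose2[OF k'(1)]) (auto intro!: continuous_intros continuous_on_compose2[OF p])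
  define \<phi> where "\<phi> g = (\<integral>h. F (g, h) \<partial>\<nu>)" for g
  have supp: "F (g, h) = 0" if "g \<in> C" "h \<notin> p -` ((\<lambda>(a, b). - b + a) ` (K \<times> C))" for g h C
  proof -
    have "g + p h \<notin> K"
    proof
      assume "g + p h \<in> K"
      then have "p h = (\<lambda>(a, b). - b + a) (g + p h, g)" "(g + p h, g) \<in> K \<times> C"
        using that(1) by (auto simp: add.assoc[symmetric])
      then have "h \<in> p -` ((\<lambda>(a, b). - b + a) ` (K \<times> C))" by blast
      then show False using that(2) by blast
    qed
    then show ?thesis by (simp add: F_def k')
  qed
  have cpt: "compact (p -` ((\<lambda>(a, b). - b + a) ` (K \<times> C)))" if "compact C" for C
    by (intro proper compact_set_diff k' that)
  have loc: "\<exists>V L. open V \<and> g \<in> V \<and> compact L \<and> (\<forall>g\<in>V. \<forall>h. h \<notin> L \<longrightarrow> F (g, h) = 0)" for g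
  proof -
    obtain V C where V: "open V" "compact C" "g \<in> V" "V \<subseteq> C" by (rule G.compact_nbhd_point)
    then show ?thesis
      using supp[of _ C] cpt[OF V(2)]
      by (intro exI[of _ V] exI[of _ "p -` ((\<lambda>(a, b). - b + a) ` (K \<times> C))"]) blast
  qed
  have \<phi>_cont: "continuous_on UNIV \<phi>" and Fint: "\<And>g. integrable \<nu> (\<lambda>h. F (g, h))"
    unfolding \<phi>_def using H.continuous_parametric_integral[OF F loc] by auto
  have F0: "0 \<le> F z" for z by (simp add: F_def split_beta k')
  have \<phi>0: "0 \<le> \<phi> g" for g unfolding \<phi>_def by (intro Bochner_Integration.integral_nonneg F0)
  have \<phi>nn: "(\<integral>\<^sup>+h. ennreal (F (g, h)) \<partial>\<nu>) = ennreal (\<phi> g)" for g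
    unfolding \<phi>_def by (rule nn_integral_eq_integral[OF Fint]) (simp add: F0)
  define M where "M = p -` ((\<lambda>(a, b). - b + a) ` (K \<times> K))"
  have M: "compact M" unfolding M_def by (rule cpt[OF k'(3)])
  \<comment> \<open>The bound is uniform in \<open>g\<close>: move \<open>g\<close> along its coset of \<open>range p\<close> into \<open>K\<close>.\<close>
  have \<phi>B: "\<phi> g \<le> \<bar>B\<bar> * measure \<nu> M" for g
  proof (cases "\<exists>h0. k (g + p h0) \<noteq> 0")
    case False
    then have "\<phi> g = 0" by (simp add: \<phi>_def F_def)
    then show ?thesis by simp
  next
    case True
    then obtain h0 where h0: "g + p h0 \<in> K" using k'(4) by blast
    have "ennreal (\<phi> g) = (\<integral>\<^sup>+h. ennreal (F (g, h0 + h)) \<partial>\<nu>)"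
      unfolding \<phi>nn[symmetric]
      by (rule H.nn_integral_left_translate[symmetric, of "\<lambda>h. ennreal (F (g, h))"]) (use Fint[of g] in auto)
    also have "\<dots> = ennreal (\<phi> (g + p h0))"
      unfolding \<phi>nn[symmetric] by (simp add: F_def hom add.assoc)
    finally have "\<phi> g = \<phi> (g + p h0)" using \<phi>0 by simp
    also have "\<dots> \<le> (\<integral>h. \<bar>B\<bar> * indicator M h \<partial>\<nu>)"
      unfolding \<phi>_def
    proof (rule integral_mono[OF Fint])
      show "integrable \<nu> (\<lambda>h. \<bar>B\<bar> * indicator M h)" using M H.finite_compact[OF M] by simp
      show "F (g + p h0, h) \<le> \<bar>B\<bar> * indicator M h" for h
        using supp[OF h0, of h] B[of "g + p h0 + p h"]
        by (cases "h \<in> M") (auto simp: M_def F_def)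
    qed
    finally show ?thesis by simp
  qed
  have \<phi>m: "\<phi> \<in> borel_measurable \<mu>" by (rule G.measurable_continuous[OF \<phi>_cont])
  have \<phi>L: "(\<lambda>g. complex_of_real (\<phi> g)) \<in> linfty_pos \<mu>"
    using \<phi>m \<phi>0 \<phi>B
    by (auto simp: linfty_pos_def linfty_def locally_ae_def complex_nonneg_Reals_iff intro!: exI[of _ "\<bar>B\<bar> * measure \<nu> M"])
  have "is_haar_integral \<mu> \<nu> (action p (\<lambda>x. complex_of_real (k x))) (\<lambda>g. complex_of_real (\<phi> g))"
    unfolding is_haar_integral_def
  proof (intro conjI ballI \<phi>L)
    fix \<omega> assume \<omega>: "\<omega> \<in> lone_pos \<mu>"
    then have \<omega>i: "integrable \<mu> \<omega>" by (auto simp: lone_pos_def lone_def)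
    define w where "w g = ennreal (Re (\<omega> g))" for g
    have w[measurable]: "w \<in> borel_measurable \<mu>" unfolding w_def using \<omega>i by auto
    have "(\<integral>\<^sup>+g. w g \<partial>\<mu>) \<le> (\<integral>\<^sup>+g. ennreal (norm (\<omega> g)) \<partial>\<mu>)"
      unfolding w_def by (intro nn_integral_mono ennreal_leI complex_Re_le_cmod)
    then have "(\<integral>\<^sup>+g. w g \<partial>\<mu>) < \<infinity>" using \<omega>i by (auto simp: integrable_iff_bounded)
    then obtain D where D: "\<And>n::nat. compact (D n)" "incseq D" "AE g in \<mu>. w g \<noteq> 0 \<longrightarrow> g \<in> (\<Union>n. D n)"
      using G.sigma_compact_carrier[OF w] by blast
    have Fg: "(\<lambda>g. F (g, h)) \<in> borel_measurable \<mu>" for h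
      by (rule G.measurable_continuous, rule continuous_on_compose2[OF F]) (auto intro!: continuous_intros)
    define J where "J n h = (\<integral>\<^sup>+g. ennreal (F (g, h)) * w g * indicator (D n) g \<partial>\<mu>)" for n h
    note ton = tonelli_compact[OF F D(1) cpt[OF D(1)] G.sets_eq_borel H.sets_eq_borel
        G.finite_compact[OF D(1)] H.finite_compact[OF cpt[OF D(1)]] w supp]
    have Jm: "J n \<in> borel_measurable \<nu>" for n unfolding J_def using ton(1) .
    have JT: "(\<integral>\<^sup>+h. J n h \<partial>\<nu>) = (\<integral>\<^sup>+g. ennreal (\<phi> g) * w g * indicator (D n) g \<partial>\<mu>)" for n
      unfolding J_def \<phi>nn[symmetric] by (rule ton(2))
    have incD: "x \<in> D n" if "x \<in> D m" "m \<le> n" for x m n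
      using D(2) that unfolding incseq_def by blast
    have Jinc: "incseq J"
      unfolding J_def
      by (auto simp: incseq_def le_fun_def intro: incD intro!: nn_integral_mono mult_left_mono split: split_indicator)
    have "ennreal (Re (slice \<mu> \<omega> (action p (\<lambda>x. complex_of_real (k x))) h)) = (SUP n. J n h)" for h
    proof -
      have "slice \<mu> \<omega> (action p (\<lambda>x. complex_of_real (k x))) h = (\<integral>g. complex_of_real (F (g, h)) * \<omega> g \<partial>\<mu>)"
        by (simp add: slice_def action_def F_def)
      also have "ennreal (Re \<dots>) = (\<integral>\<^sup>+g. ennreal (F (g, h)) * w g \<partial>\<mu>)"
        unfolding w_def by (rule G.nn_integral_pairing[OF Fg F0 _ \<omega>]) (unfold F_def prod.case, rule B)
      also have "\<dots> = (SUP n. J n h)"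
        unfolding J_def by (rule G.nn_integral_carrier_SUP[OF _ w D]) (use Fg in simp)
      finally show ?thesis .
    qed
    then have "(\<integral>\<^sup>+h. ennreal (Re (slice \<mu> \<omega> (action p (\<lambda>x. complex_of_real (k x))) h)) \<partial>\<nu>) = (\<integral>\<^sup>+h. (SUP n. J n h) \<partial>\<nu>)"
      by simp
    also have "\<dots> = (SUP n. \<integral>\<^sup>+h. J n h \<partial>\<nu>)"
      by (rule nn_integral_monotone_convergence_SUP[OF Jinc Jm])
    also have "\<dots> = (\<integral>\<^sup>+g. ennreal (\<phi> g) * w g \<partial>\<mu>)"
      unfolding JT by (rule G.nn_integral_carrier_SUP[OF _ w D, symmetric]) (use \<phi>m in simp)
    also have "\<dots> = ennreal (Re (\<integral>g. complex_of_real (\<phi> g) * \<omega> g \<partial>\<mu>))"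
      unfolding w_def by (rule G.nn_integral_pairing[OF \<phi>m \<phi>0 \<phi>B \<omega>, symmetric])
    finally show "(\<integral>\<^sup>+h. ennreal (Re (slice \<mu> \<omega> (action p (\<lambda>x. complex_of_real (k x))) h)) \<partial>\<nu>)
        = ennreal (Re (\<integral>g. complex_of_real (\<phi> g) * \<omega> g \<partial>\<mu>))" .
  qed
  then show ?thesis
    using G.cc_pos_linfty_pos[OF k] unfolding integrable_elements_def by blast
qed

lemma closed_embedding_proper:
  fixes p :: "'h::topological_space \<Rightarrow> 'g::t2_space"
  assumes "closed (range p)" "homeomorphic_map euclidean (top_of_set (range p)) p" "compact C"
  shows "compact (p -` C)"
proof -
  obtain q where q: "homeomorphic_maps euclidean (top_of_set (range p)) p q"
    using assms(2) homeomorphic_map_maps by blast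
  then have "continuous_on (range p) q" "\<And>x. q (p x) = x"
    by (auto simp: homeomorphic_maps_def)
  then have "compact (q ` (C \<inter> range p))"
    using assms(1,3) by (intro compact_continuous_image compact_Int_closed) (auto intro: continuous_on_subset)
  moreover have "q ` (C \<inter> range p) = p -` C"
  proof
    show "q ` (C \<inter> range p) \<subseteq> p -` C" using \<open>\<And>x. q (p x) = x\<close> by auto
    show "p -` C \<subseteq> q ` (C \<inter> range p)"
    proof
      fix x assume "x \<in> p -` C"
      then have "p x \<in> C \<inter> range p" by simp
      then have "q (p x) \<in> q ` (C \<inter> range p)" by (rule imageI)
      then show "x \<in> q ` (C \<inter> range p)" using \<open>\<And>x. q (p x) = x\<close> by simp
    qed
  qed
  ultimately show ?thesis by simp
qed

section \<open>Integrable actions come from closed embeddings\<close>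

text \<open>
  Used to pick an integrable element that is not locally null.
\<close>
lemma openin_nonvanishing_pairing:
  assumes "\<omega> \<in> lone \<mu>"
  shows "openin (sigma_weak \<mu>) {f \<in> linfty \<mu>. (\<integral>x. f x * \<omega> x \<partial>\<mu>) \<noteq> 0}"
proof -
  let ?P = "product_topology (\<lambda>_. euclidean :: complex topology) (lone \<mu>)"
  have "openin ?P {u \<in> topspace ?P. u \<omega> \<in> - {0}}"
    by (rule openin_continuous_map_preimage[OF continuous_map_product_projection[OF assms]]) auto
  moreover have "{f \<in> linfty \<mu>. (\<integral>x. f x * \<omega> x \<partial>\<mu>) \<noteq> 0}
      = (\<lambda>f. \<lambda>\<omega>\<in>lone \<mu>. \<integral>x. f x * \<omega> x \<partial>\<mu>) -` {u \<in> topspace ?P. u \<omega> \<in> - {0}} \<inter> linfty \<mu>"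
    using assms by auto
  ultimately show ?thesis unfolding sigma_weak_def openin_pullback_topology by blast
qed

lemma (in left_haar) AE_right_translate:
  assumes "AE x in \<mu>. P x"
  shows "AE t in \<mu>. P (t + s)"
proof -
  obtain N where N: "{x \<in> space \<mu>. \<not> P x} \<subseteq> N" "N \<in> null_sets \<mu>"
    using assms by (auto simp: eventually_ae_filter)
  then have "{t \<in> space \<mu>. \<not> P (t + s)} \<subseteq> (\<lambda>t. t + s) -` N" by auto
  then show ?thesis using null_sets_right_translate[OF N(2), of s] by (auto simp: eventually_ae_filter)
qed

lemma (in radon_measure) indicator_compact_lone_pos:
  assumes "compact Q"
  shows "indicator Q \<in> lone_pos \<mu>"
proof -
  have [measurable]: "Q \<in> sets \<mu>" using assms by simp
  have "integrable \<mu> (indicator Q :: 'a \<Rightarrow> complex)"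
    using finite_compact[OF assms]
    by (intro integrableI_bounded_set[of Q _ _ 1]) auto
  then show ?thesis by (auto simp: lone_pos_def lone_def indicator_def)
qed

text \<open>
  The constant \<open>1\<close> has a nonzero pairing with the indicator of a compact neighbourhood, and by density so
  does some integrable element.
\<close>
lemma (in left_haar) integrable_action_nonzero_element:
  assumes "integrable_action \<mu> \<nu> p"
  obtains f C where "f \<in> integrable_elements \<mu> \<nu> p" "compact C"
    "(\<integral>x. f x * indicator C x \<partial>\<mu>) \<noteq> 0"
proof -
  obtain V C where V: "open V" "compact C" "(0::'a) \<in> V" "V \<subseteq> C" by (rule compact_nbhd_point)
  have \<omega>: "indicator C \<in> lone \<mu>"
    using indicator_compact_lone_pos[OF V(2)] by (simp add: lone_pos_def)
  have one: "(\<lambda>_. 1) \<in> linfty_pos \<mu>"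
    by (auto simp: linfty_pos_def linfty_def locally_ae_def intro!: exI[of _ 1])
  have "measure \<mu> C > 0"
  proof -
    have "0 < emeasure \<mu> V" using V by (intro open_positive) auto
    also have "\<dots> \<le> emeasure \<mu> C" using V by (intro emeasure_mono) auto
    finally show ?thesis
      using finite_compact[OF V(2)] by (simp add: measure_def enn2real_positive_iff)
  qed
  moreover have "(\<integral>x. 1 * indicator C x \<partial>\<mu>) = complex_of_real (measure \<mu> C)"
  proof -
    have "(\<integral>x. complex_of_real (indicator C x) \<partial>\<mu>) = complex_of_real (measure \<mu> C)"
      using V(2) unfolding integral_complex_of_real by simp
    then show ?thesis by (simp add: of_real_indicator)
  qed
  ultimately have "(\<integral>x. 1 * indicator C x \<partial>\<mu>) \<noteq> (0::complex)" by simp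
  then have "(\<lambda>_. 1) \<in> {f \<in> linfty \<mu>. (\<integral>x. f x * indicator C x \<partial>\<mu>) \<noteq> 0}"
    using one linfty_pos_subset by auto
  moreover have "(\<lambda>_. 1) \<in> sigma_weak \<mu> closure_of integrable_elements \<mu> \<nu> p"
    using assms one by (auto simp: integrable_action_def)
  ultimately have "\<exists>f. f \<in> integrable_elements \<mu> \<nu> p \<and> f \<in> {f \<in> linfty \<mu>. (\<integral>x. f x * indicator C x \<partial>\<mu>) \<noteq> 0}"
    using openin_nonvanishing_pairing[OF \<omega>] unfolding in_closure_of by (elim conjE allE) (erule mp, simp)
  then obtain f where "f \<in> integrable_elements \<mu> \<nu> p" "(\<integral>x. f x * indicator C x \<partial>\<mu>) \<noteq> 0"
    by (elim exE conjE CollectE)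
  then show ?thesis using that V(2) by metis
qed

text \<open>
  If all the countably many sets \<open>{x \<in> C. Re (f x) \<ge> 1 / (n + 1)}\<close> were null, \<open>f\<close> would vanish almost
  everywhere on \<open>C\<close>; inner regularity finds \<open>K\<close> inside one that is not.
\<close>
lemma (in left_haar) positive_on_compact:
  assumes f: "f \<in> linfty_pos \<mu>" and C: "compact C" and nz: "(\<integral>x. f x * indicator C x \<partial>\<mu>) \<noteq> 0"
  obtains K c where "compact K" "emeasure \<mu> K > 0" "c > 0" "\<And>x. x \<in> K \<Longrightarrow> c \<le> Re (f x)"
proof -
  have [measurable]: "f \<in> borel_measurable \<mu>" "C \<in> sets \<mu>"
    and pos: "AE x in \<mu>. x \<in> C \<longrightarrow> f x \<in> \<real>\<^sub>\<ge>\<^sub>0"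
    using f C finite_compact[OF C] by (auto simp: linfty_pos_def linfty_def locally_ae_def)
  define A where "A n = {x \<in> space \<mu>. x \<in> C \<and> inverse (real (Suc n)) \<le> Re (f x)}" for n
  have A: "A n \<in> sets \<mu>" for n unfolding A_def by measurable
  have "\<exists>n. emeasure \<mu> (A n) > 0"
  proof (rule ccontr)
    assume "\<not> (\<exists>n. emeasure \<mu> (A n) > 0)"
    then have "A n \<in> null_sets \<mu>" for n using A by (auto simp: null_sets_def zero_less_iff_neq_zero)
    then have "AE x in \<mu>. \<forall>n. x \<notin> A n" unfolding AE_all_countable by (auto intro: AE_not_in)
    then have "AE x in \<mu>. f x * indicator C x = 0"
      using pos
    proof eventually_elim
      case (elim x)
      show ?case
      proof (cases "x \<in> C")
        case True
        have "\<not> Re (f x) > 0"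
        proof
          assume "Re (f x) > 0"
          then obtain n where "inverse (real (Suc n)) < Re (f x)" using reals_Archimedean by blast
          then have "x \<in> A n" using True by (simp add: A_def del: of_nat_Suc)
          then show False using elim by blast
        qed
        then have "f x = 0" using elim True by (simp add: complex_nonneg_Reals_iff complex_eq_iff)
        then show ?thesis by simp
      qed simp
    qed
    then have "(\<integral>x. f x * indicator C x \<partial>\<mu>) = 0" by (rule integral_eq_zero_AE)
    then show False using nz by simp
  qed
  then obtain n where n: "emeasure \<mu> (A n) > 0" by blast
  have "A n \<subseteq> C" by (auto simp: A_def)
  then have "emeasure \<mu> (A n) < \<infinity>"
    using emeasure_mono[of "A n" C \<mu>] finite_compact[OF C] by (auto intro: le_less_trans)
  then obtain K where "compact K" "K \<subseteq> A n" "emeasure \<mu> K > 0"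
    using compact_subset_positive[of "A n"] A n by (auto simp: sets_eq_borel)
  then show ?thesis using that[of K "inverse (real (Suc n))"] by (auto simp: A_def)
qed

text \<open>
  The condition \<open>KQ\<close> puts the translate \<open>K - s\<close> inside \<open>Q\<close>, where \<open>Re (f (t + s)) \<ge> c\<close> on \<open>K - s\<close>
  and \<open>f (t + s) \<ge> 0\<close> almost everywhere. The latter holds because right translations preserve null sets.
\<close>
lemma (in left_haar) slice_lower_bound:
  assumes f: "f \<in> linfty_pos \<mu>" and Q: "compact Q" and K: "compact K"
    and c: "c \<ge> 0" "\<And>x. x \<in> K \<Longrightarrow> c \<le> Re (f x)" and KQ: "\<And>x. x \<in> K \<Longrightarrow> x - s \<in> Q"
  shows "c * measure \<mu> ((\<lambda>t. t + s) -` K) \<le> Re (\<integral>t. f (t + s) * indicator Q t \<partial>\<mu>)"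
proof -
  obtain B where B: "locally_ae \<mu> (\<lambda>x. norm (f x) \<le> B)" and pos: "locally_ae \<mu> (\<lambda>x. f x \<in> \<real>\<^sub>\<ge>\<^sub>0)"
    and fm: "f \<in> borel_measurable \<mu>"
    using f by (auto simp: linfty_pos_def linfty_def)
  define Q' where "Q' = (\<lambda>t. t + s) ` Q"
  have Q': "compact Q'" unfolding Q'_def by (intro compact_continuous_image Q continuous_intros)
  have "AE x in \<mu>. x \<in> Q' \<longrightarrow> norm (f x) \<le> B \<and> f x \<in> \<real>\<^sub>\<ge>\<^sub>0"
  proof -
    have "AE x in \<mu>. x \<in> Q' \<longrightarrow> norm (f x) \<le> B" "AE x in \<mu>. x \<in> Q' \<longrightarrow> f x \<in> \<real>\<^sub>\<ge>\<^sub>0"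
      using B pos Q' finite_compact[OF Q'] by (auto simp: locally_ae_def)
    then show ?thesis by eventually_elim auto
  qed
  from AE_right_translate[OF this, of s]
  have ae: "AE t in \<mu>. t \<in> Q \<longrightarrow> norm (f (t + s)) \<le> B \<and> f (t + s) \<in> \<real>\<^sub>\<ge>\<^sub>0"
    by eventually_elim (auto simp: Q'_def)
  have [measurable]: "(\<lambda>t. f (t + s)) \<in> borel_measurable \<mu>"
    using measurable_compose[OF measurable_translate(2)[of s] fm] .
  have [measurable]: "Q \<in> sets \<mu>" using Q by simp
  have int: "integrable \<mu> (\<lambda>t. f (t + s) * indicator Q t)"
    by (rule integrableI_bounded_set[of Q _ _ B])
       (use finite_compact[OF Q] ae in \<open>auto split: split_indicator elim!: eventually_mono\<close>)
  have K': "compact ((\<lambda>t. t + s) -` K)" by (rule compact_right_translate_vimage[OF K])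
  have "c * measure \<mu> ((\<lambda>t. t + s) -` K) = (\<integral>t. c * indicator ((\<lambda>t. t + s) -` K) t \<partial>\<mu>)"
    using K' by simp
  also have "\<dots> \<le> (\<integral>t. Re (f (t + s) * indicator Q t) \<partial>\<mu>)"
  proof (rule integral_mono_AE)
    show "integrable \<mu> (\<lambda>t. c * indicator ((\<lambda>t. t + s) -` K) t)"
      using K' finite_compact[OF K'] by simp
    show "integrable \<mu> (\<lambda>t. Re (f (t + s) * indicator Q t))" using int by (rule integrable_Re)
    show "AE t in \<mu>. c * indicator ((\<lambda>t. t + s) -` K) t \<le> Re (f (t + s) * indicator Q t)"
      using ae
    proof eventually_elim
      case (elim t)
      have "t + s \<in> K \<Longrightarrow> t \<in> Q" using KQ[of "t + s"] by simp
      then show ?case using elim c(2)[of "t + s"]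
        by (auto simp: complex_nonneg_Reals_iff split: split_indicator)
    qed
  qed
  also have "\<dots> = Re (\<integral>t. f (t + s) * indicator Q t \<partial>\<mu>)" by (rule integral_Re[OF int])
  finally show ?thesis .
qed

text \<open>
  Near \<open>0\<close> the slices of \<open>f\<close> with the indicator of \<open>Q\<close> are at least \<open>c \<mu> (K - p h) \<ge> c \<mu> K / 2\<close>, while
  their integral over \<open>H\<close> is finite.
\<close>
lemma integrable_action_finite_nbhd:
  fixes p :: "'h::{topological_group_add,t2_space} \<Rightarrow> 'g::{topological_group_add,t2_space}"
  assumes "left_haar \<mu>" "left_haar \<nu>" and p: "continuous_on UNIV p"
    and act: "integrable_action \<mu> \<nu> p"
  obtains N where "open N" "0 \<in> N" "emeasure \<nu> (p -` N) < \<infinity>"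
proof -
  interpret G: left_haar \<mu> by fact
  interpret H: left_haar \<nu> by fact
  obtain f C where fC: "f \<in> integrable_elements \<mu> \<nu> p" "compact C" "(\<integral>x. f x * indicator C x \<partial>\<mu>) \<noteq> 0"
    using G.integrable_action_nonzero_element[OF act] .
  then have f: "f \<in> linfty_pos \<mu>" by (auto simp: integrable_elements_def)
  obtain \<phi> where \<phi>: "is_haar_integral \<mu> \<nu> (action p f) \<phi>" using fC(1) by (auto simp: integrable_elements_def)
  obtain K c where K: "compact K" "emeasure \<mu> K > 0" "c > 0" "\<And>x. x \<in> K \<Longrightarrow> c \<le> Re (f x)"
    using G.positive_on_compact[OF f fC(2,3)] by blast
  obtain V Q where V: "open V" "compact Q" "K \<subseteq> V" "V \<subseteq> Q" using G.compact_nbhd[OF K(1)] .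
  \<comment> \<open>A neighbourhood \<open>W\<close> of \<open>0\<close> with \<open>K - s \<subseteq> Q\<close> for all \<open>s \<in> W\<close>.\<close>
  have "open ((\<lambda>(s, x). x - s) -` V)"
    unfolding split_beta by (intro open_vimage V continuous_intros)
  moreover have "{0} \<times> K \<subseteq> (\<lambda>(s, x). x - s) -` V" using V by auto
  ultimately obtain W where W: "0 \<in> W" "open W" "W \<times> K \<subseteq> (\<lambda>(s, x). x - s) -` V"
    using Elementary_Topology.tube_lemma[OF K(1)] by metis
  obtain \<Delta> :: "'g \<Rightarrow> real" where \<Delta>: "continuous_on UNIV \<Delta>" "\<Delta> 0 = 1"
    "\<And>s A. A \<in> sets borel \<Longrightarrow> ennreal (\<Delta> s) * emeasure \<mu> A \<le> emeasure \<mu> ((\<lambda>t. t + s) -` A)"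
    using G.modular_function by metis
  define N where "N = W \<inter> {s. 1 / 2 < \<Delta> s}"
  have N: "open N" "0 \<in> N"
    unfolding N_def using W \<Delta> by (auto intro!: open_Int open_Collect_less continuous_intros)
  define d where "d = c * (measure \<mu> K / 2)"
  have mK: "emeasure \<mu> K = ennreal (measure \<mu> K)"
    using G.finite_compact[OF K(1)] by (intro emeasure_eq_ennreal_measure) auto
  then have "measure \<mu> K > 0" using K(2) by simp
  then have d: "d > 0" using K(3) by (simp add: d_def)
  have lower: "d \<le> Re (slice \<mu> (indicator Q) (action p f) h)" if h: "p h \<in> N" for h
  proof -
    have "measure \<mu> K / 2 \<le> measure \<mu> ((\<lambda>t. t + p h) -` K)"
    proof -
      have K': "compact ((\<lambda>t. t + p h) -` K)" by (rule compact_right_translate_vimage[OF K(1)])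
      have "ennreal (1 / 2 * measure \<mu> K) \<le> ennreal (\<Delta> (p h) * measure \<mu> K)"
        using h by (intro ennreal_leI mult_right_mono) (auto simp: N_def)
      also have "\<dots> = ennreal (\<Delta> (p h)) * emeasure \<mu> K"
        unfolding mK by (rule ennreal_mult) (use h in \<open>auto simp: N_def\<close>)
      also have "\<dots> \<le> emeasure \<mu> ((\<lambda>t. t + p h) -` K)"
        using K(1) by (intro \<Delta>(3)) (simp add: compact_imp_closed)
      also have "\<dots> = ennreal (measure \<mu> ((\<lambda>t. t + p h) -` K))"
        using G.finite_compact[OF K'] by (intro emeasure_eq_ennreal_measure) auto
      finally show ?thesis by simp
    qed
    then have "d \<le> c * measure \<mu> ((\<lambda>t. t + p h) -` K)"
      unfolding d_def using K(3) by (intro mult_left_mono) auto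
    also have "\<dots> \<le> Re (\<integral>t. f (t + p h) * indicator Q t \<partial>\<mu>)"
      by (rule G.slice_lower_bound[OF f V(2) K(1)]) (use K V W(3) h in \<open>auto simp: N_def\<close>)
    finally show ?thesis by (simp add: slice_def action_def)
  qed
  have pN: "open (p -` N)" by (rule open_vimage[OF N(1) p])
  have "indicator Q \<in> lone_pos \<mu>" by (rule G.indicator_compact_lone_pos[OF V(2)])
  then have fin: "(\<integral>\<^sup>+h. ennreal (Re (slice \<mu> (indicator Q) (action p f) h)) \<partial>\<nu>) < \<infinity>"
    using \<phi> unfolding is_haar_integral_def by simp
  have "ennreal d * emeasure \<nu> (p -` N) = (\<integral>\<^sup>+h. ennreal d * indicator (p -` N) h \<partial>\<nu>)"
    using pN by (simp add: nn_integral_cmult_indicator)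
  also have "\<dots> \<le> (\<integral>\<^sup>+h. ennreal (Re (slice \<mu> (indicator Q) (action p f) h)) \<partial>\<nu>)"
    using lower by (intro nn_integral_mono) (auto intro!: ennreal_leI split: split_indicator)
  finally have "ennreal d * emeasure \<nu> (p -` N) < \<infinity>" using fin by (rule le_less_trans)
  then have "emeasure \<nu> (p -` N) < \<infinity>" using d by (auto simp: ennreal_mult_less_top)
  then show ?thesis using that N by blast
qed

lemma group_hom_zero_minus:
  fixes p :: "'h::group_add \<Rightarrow> 'g::group_add"
  assumes hom: "\<And>x y. p (x + y) = p x + p y"
  shows "p 0 = 0" "p (- x) = - p x"
proof -
  have "p 0 + p 0 = p 0 + 0" using hom[of 0 0] by simp
  then show p0: "p 0 = 0" by (rule add_left_imp_eq)
  have "p x + p (- x) = 0" using hom[of x "- x"] p0 by simp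
  then show "p (- x) = - p x" by (rule minus_unique[symmetric])
qed

text \<open>
  Choose \<open>W + W \<subseteq> N\<close> and a small open \<open>V\<close> around \<open>0\<close> in \<open>H\<close> with \<open>p ` V \<subseteq> W\<close>. Disjoint translates of
  \<open>V\<close> by elements of \<open>p -` W\<close> lie in \<open>p -` N\<close>, so their number is bounded. For a maximal family, every
  element of \<open>p -` W\<close> has its translate of \<open>V\<close> meeting one from the family, and so lies within
  \<open>V - V\<close> of one of finitely many points.
\<close>
lemma finite_nbhd_imp_compact_nbhd:
  fixes p :: "'h::{topological_group_add,t2_space} \<Rightarrow> 'g::{topological_group_add,t2_space}"
  assumes "left_haar \<nu>" and p: "continuous_on UNIV p" and hom: "\<And>x y. p (x + y) = p x + p y"
    and N: "open N" "0 \<in> N" "emeasure \<nu> (p -` N) < \<infinity>"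
  obtains W M where "open W" "0 \<in> W" "compact M" "p -` W \<subseteq> M"
proof -
  interpret H: left_haar \<nu> by fact
  have p0: "p 0 = 0" by (rule group_hom_zero_minus(1)[OF hom])
  have "open ((\<lambda>(a, b). a + b) -` N)"
    unfolding split_beta by (intro open_vimage N continuous_intros)
  then obtain A B where AB: "open A" "open B" "(0, 0) \<in> A \<times> B" "A \<times> B \<subseteq> (\<lambda>(a, b). a + b) -` N"
    using N(2) by (elim open_prod_elim[of _ "(0, 0)"]) auto
  define W where "W = A \<inter> B"
  have W: "open W" "0 \<in> W" "\<And>a b. a \<in> W \<Longrightarrow> b \<in> W \<Longrightarrow> a + b \<in> N" using AB by (auto simp: W_def)
  obtain V0 C where V0: "open V0" "compact C" "(0::'h) \<in> V0" "V0 \<subseteq> C" by (rule H.compact_nbhd_point)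
  define V where "V = V0 \<inter> p -` W"
  have V: "open V" "0 \<in> V" "V \<subseteq> C" "V \<subseteq> p -` W"
    using V0 W p0 by (auto simp: V_def intro!: open_Int open_vimage p)
  have Vpos: "emeasure \<nu> V > 0" using V by (intro H.open_positive) auto
  have Vfin: "emeasure \<nu> V < \<infinity>"
    using emeasure_mono[OF V(3), of \<nu>] V0 H.finite_compact[OF V0(2)] by (auto intro: le_less_trans)
  have tr: "open ((\<lambda>x. h + x) ` V)" "emeasure \<nu> ((\<lambda>x. h + x) ` V) = emeasure \<nu> V" for h
  proof -
    show "open ((\<lambda>x. h + x) ` V)"
      unfolding left_translate_image_eq_vimage by (rule open_translate_vimage(2)[OF V(1)])
    show "emeasure \<nu> ((\<lambda>x. h + x) ` V) = emeasure \<nu> V"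
      using V(1) by (intro H.left_invariant) auto
  qed
  define P where "P T \<longleftrightarrow> finite T \<and> T \<subseteq> p -` W \<and> disjoint_family_on (\<lambda>h. (\<lambda>x. h + x) ` V) T" for T
  \<comment> \<open>Disjoint translates of \<open>V\<close> inside \<open>p -` N\<close> number at most \<open>\<nu> (p -` N) / \<nu> V\<close>.\<close>
  define b where "b = nat \<lceil>measure \<nu> (p -` N) / measure \<nu> V\<rceil>"
  have mV: "emeasure \<nu> V = ennreal (measure \<nu> V)" "measure \<nu> V > 0"
    using Vpos Vfin by (auto simp: measure_def enn2real_positive_iff less_top)
  have mN: "emeasure \<nu> (p -` N) = ennreal (measure \<nu> (p -` N))"
    using N(3) by (intro emeasure_eq_ennreal_measure) auto
  have bound: "card T \<le> b" if "P T" for T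
  proof -
    have "ennreal (real (card T) * measure \<nu> V) = (\<Sum>h\<in>T. emeasure \<nu> ((\<lambda>x. h + x) ` V))"
      by (simp add: tr mV ennreal_mult ennreal_of_nat_eq_real_of_nat)
    also have "\<dots> = emeasure \<nu> (\<Union>h\<in>T. (\<lambda>x. h + x) ` V)"
      using that tr by (intro sum_emeasure) (auto simp: P_def)
    also have "\<dots> \<le> emeasure \<nu> (p -` N)"
    proof (rule emeasure_mono)
      show "(\<Union>h\<in>T. (\<lambda>x. h + x) ` V) \<subseteq> p -` N"
      proof clarify
        fix h v assume "h \<in> T" "v \<in> V"
        then have "p h \<in> W" "p v \<in> W" using that V(4) by (auto simp: P_def)
        then show "h + v \<in> p -` N" using W(3) by (simp add: hom)
      qed
      show "p -` N \<in> sets \<nu>" using open_vimage[OF N(1) p] by simp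
    qed
    finally have "real (card T) * measure \<nu> V \<le> measure \<nu> (p -` N)"
      unfolding mN by (subst (asm) ennreal_le_iff) auto
    then have "real (card T) \<le> measure \<nu> (p -` N) / measure \<nu> V"
      using mV(2) by (simp add: field_simps)
    then show ?thesis unfolding b_def by linarith
  qed
  have "P {}" by (auto simp: P_def disjoint_family_on_def)
  moreover have "\<forall>T. P T \<longrightarrow> card T < Suc b" using bound by (simp add: less_Suc_eq_le)
  ultimately have "\<exists>T. P T \<and> (\<forall>T'. P T' \<longrightarrow> card T' \<le> card T)" by (rule Lattices_Big.ex_has_greatest_nat)
  then obtain T where T: "P T" "\<And>T'. P T' \<Longrightarrow> card T' \<le> card T" by (elim exE conjE) simp
  define D where "D = (\<lambda>(a, b). a - b) ` (C \<times> C)"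
  define M where "M = (\<Union>t\<in>T. (\<lambda>x. t + x) ` D)"
  have "compact M"
    unfolding M_def D_def using T(1)
    by (intro compact_UN compact_continuous_image compact_set_diff V0 continuous_intros) (auto simp: P_def)
  moreover have "p -` W \<subseteq> M"
  proof
    fix h assume h: "h \<in> p -` W"
    have "\<exists>t\<in>T. (\<lambda>x. h + x) ` V \<inter> (\<lambda>x. t + x) ` V \<noteq> {}"
    proof (rule ccontr)
      assume no: "\<not> (\<exists>t\<in>T. (\<lambda>x. h + x) ` V \<inter> (\<lambda>x. t + x) ` V \<noteq> {})"
      then have "h \<notin> T" using V(2) by auto
      moreover have "P (insert h T)"
        using T(1) h no unfolding P_def disjoint_family_on_def by (auto simp: Int_commute)
      ultimately show False using T(2)[of "insert h T"] T(1) by (auto simp: P_def)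
    qed
    then obtain t v v' where t: "t \<in> T" "v \<in> V" "v' \<in> V" "h + v = t + v'" by blast
    \<comment> \<open>The translates by \<open>h\<close> and \<open>t\<close> share a point, so \<open>h\<close> lies in \<open>t + (V - V)\<close>.\<close>
    then have "h = t + (v' - v)" by (metis add_diff_cancel add_diff_eq)
    moreover have "v' - v \<in> D" using t V(3) by (force simp: D_def)
    ultimately show "h \<in> M" using t(1) by (auto simp: M_def)
  qed
  ultimately show ?thesis using that W by blast
qed

text \<open>
  Only the part of \<open>p ` S\<close> close to a given point \<open>y\<close> matters. If \<open>p h0\<close> is close to \<open>y\<close>, all \<open>h\<close> with \<open>p h\<close>
  close to \<open>y\<close> lie in the compact set \<open>h0 + M\<close>, and the image of its intersection with \<open>S\<close> is compact.
\<close>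
lemma compact_nbhd_imp_closed_map:
  fixes p :: "'h::{topological_group_add,t2_space} \<Rightarrow> 'g::{topological_group_add,t2_space}"
  assumes p: "continuous_on UNIV p" and hom: "\<And>x y. p (x + y) = p x + p y"
    and W: "open W" "0 \<in> W" and M: "compact M" "p -` W \<subseteq> M" and S: "closed S"
  shows "closed (p ` S)"
proof -
  have pm: "p (- x) = - p x" for x
    by (rule group_hom_zero_minus(2)[OF hom])
  have "open ((\<lambda>(a, b). - a + b) -` W)"
    unfolding split_beta by (intro open_vimage W continuous_intros)
  then obtain A B where AB: "open A" "open B" "(0, 0) \<in> A \<times> B" "A \<times> B \<subseteq> (\<lambda>(a, b). - a + b) -` W"
    using W(2) by (elim open_prod_elim[of _ "(0, 0)"]) auto
  define U where "U = A \<inter> B"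
  have U: "open U" "0 \<in> U" "\<And>a b. a \<in> U \<Longrightarrow> b \<in> U \<Longrightarrow> - a + b \<in> W" using AB by (auto simp: U_def)
  have "\<exists>O'. open O' \<and> y \<in> O' \<and> O' \<subseteq> - (p ` S)" if y: "y \<notin> p ` S" for y
  proof (cases "(\<lambda>x. - y + x) -` U \<inter> p ` S = {}")
    case True
    then show ?thesis
      using open_translate_vimage(2)[OF U(1), of "- y"] U(2) by (intro exI[of _ "(\<lambda>x. - y + x) -` U"]) auto
  next
    case False
    then obtain h0 where h0: "- y + p h0 \<in> U" by auto
    define M' where "M' = (\<lambda>h. h0 + h) ` M"
    have "compact M'" unfolding M'_def by (intro compact_continuous_image M continuous_intros)
    then have "compact (p ` (S \<inter> M'))"
      using S p by (intro compact_continuous_image closed_Int_compact) (auto intro: continuous_on_subset)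
    then have "closed (p ` (S \<inter> M'))" by (rule compact_imp_closed)
    define O' where "O' = - (p ` (S \<inter> M')) \<inter> (\<lambda>x. - y + x) -` U"
    have "open O'"
      unfolding O'_def using \<open>closed (p ` (S \<inter> M'))\<close> open_translate_vimage(2)[OF U(1), of "- y"] by auto
    moreover have "y \<in> O'" using y U(2) by (auto simp: O'_def)
    moreover have "p h \<notin> O'" if "h \<in> S" for h
    proof
      assume "p h \<in> O'"
      then have nM: "h \<notin> M'" and hU: "- y + p h \<in> U" using that by (auto simp: O'_def)
      have "p (- h0 + h) = - (- y + p h0) + (- y + p h)"
        by (simp add: hom pm minus_add add.assoc)
      also have "\<dots> \<in> W" by (rule U(3)[OF h0 hU])
      finally have "- h0 + h \<in> M" using M(2) by blast
      then have "h0 + (- h0 + h) \<in> M'" unfolding M'_def by blast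
      then show False using nM by (simp add: add.assoc[symmetric])
    qed
    ultimately show ?thesis by blast
  qed
  then have nbhd: "\<exists>O'. open O' \<and> y \<in> O' \<and> O' \<subseteq> - (p ` S)" if "y \<in> - (p ` S)" for y
    using that by simp
  have "open (- (p ` S))" by (rule topological_space_class.openI) (rule nbhd)
  then show ?thesis by (simp add: closed_def)
qed

lemma left_haar_measure_imp_left_haar:
  assumes "locally_compact_space (euclidean :: 'a::{topological_group_add,t2_space} topology)"
    and "left_haar_measure (\<mu> :: 'a measure)"
  shows "left_haar \<mu>"
proof (intro left_haar.intro radon_measure.intro left_haar_axioms.intro)
  note haar = assms(2)[unfolded left_haar_measure_def]
  show "locally_compact_space (euclidean :: 'a topology)" by (rule assms(1))
  show "sets \<mu> = sets borel" using haar by meson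
  show "emeasure \<mu> K < \<infinity>" if "compact K" for K using haar that by meson
  show "emeasure \<mu> A = (INF U\<in>{U. open U \<and> A \<subseteq> U}. emeasure \<mu> U)" if "A \<in> sets borel" for A
    using haar that by meson
  show "emeasure \<mu> U = (SUP K\<in>{K. compact K \<and> K \<subseteq> U}. emeasure \<mu> K)" if "open U" for U
    using haar that by meson
  show "emeasure \<mu> UNIV \<noteq> 0" using haar by meson
  show "emeasure \<mu> ((\<lambda>x. g + x) ` A) = emeasure \<mu> A" if "A \<in> sets borel" for g A
    using haar that by meson
qed

theorem corollary7p2:
  fixes p :: "'h::{topological_group_add,t2_space} \<Rightarrow> 'g::{topological_group_add,t2_space}"
    and \<mu> :: "'g measure" and \<nu> :: "'h measure"
  assumes "locally_compact_space (euclidean :: 'g topology)"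
    and "locally_compact_space (euclidean :: 'h topology)"
    and "left_haar_measure \<mu>"
    and "left_haar_measure \<nu>"
    and "continuous_on UNIV p"
    and "inj p"
    and "\<And>x y. p (x + y) = p x + p y"
  shows "closed (range p) \<and> homeomorphic_map euclidean (top_of_set (range p)) p
         \<longleftrightarrow> integrable_action \<mu> \<nu> p"
proof -
  have G: "left_haar \<mu>" by (rule left_haar_measure_imp_left_haar[OF assms(1,3)])
  have H: "left_haar \<nu>" by (rule left_haar_measure_imp_left_haar[OF assms(2,4)])
  interpret G: left_haar \<mu> by (rule G)
  show ?thesis
  proof
    assume emb: "closed (range p) \<and> homeomorphic_map euclidean (top_of_set (range p)) p"
    have "(\<lambda>x. complex_of_real (k x)) \<in> integrable_elements \<mu> \<nu> p" if "k \<in> cc_pos" for k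
      by (rule cc_pos_integrable_element[OF G H assms(5,7) _ that])
         (use emb closed_embedding_proper in blast)
    then show "integrable_action \<mu> \<nu> p"
      unfolding integrable_action_def by (rule G.cc_pos_sigma_weak_dense)
  next
    assume act: "integrable_action \<mu> \<nu> p"
    obtain N where N: "open N" "0 \<in> N" "emeasure \<nu> (p -` N) < \<infinity>"
      using integrable_action_finite_nbhd[OF G H assms(5) act] .
    obtain W M where W: "open W" "0 \<in> W" "compact M" "p -` W \<subseteq> M"
      using finite_nbhd_imp_compact_nbhd[OF H assms(5,7) N] by blast
    have closed: "closed (p ` S)" if "closed S" for S
      by (rule compact_nbhd_imp_closed_map[OF assms(5,7) W that])
    have "homeomorphic_map euclidean (top_of_set (range p)) p"
    proof (rule bijective_closed_imp_homeomorphic_map)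
      show "continuous_map euclidean (top_of_set (range p)) p"
        using assms(5) by (simp add: continuous_map_in_subtopology)
      show "closed_map euclidean (top_of_set (range p)) p"
        unfolding closed_map_def using closed by (auto intro: closed_subset)
    qed (use assms(6) in auto)
    then show "closed (range p) \<and> homeomorphic_map euclidean (top_of_set (range p)) p"
      using closed[of UNIV] by simp
  qed
qed

end
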